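(* Let $d\ge 2$ be an integer and let $1\le p\le\infty$. For each odd prime power $q$ and each $j\in\mathbb F_q^*$, let $d\mu_j$ be the normalized surface measure on the Product $j$-variety $\Pi_j=\{x\in\mathbb F_q^d:\prod_{k=1}^d x_k=j\}$. Then there is a constant $C$ independent of $q$ such that, for every odd prime power $q$, the inequality $$\left\|\sup_{j\in\mathbb F_q^*}|f\ast d\mu_j|\right\|_{L^p(\mathbb F_q^d)}\le C\,\|f\|_{L^p(\mathbb F_q^d)}$$ holds for all functions $f:\mathbb F_q^d\to\mathbb C$, if and only if $p\ge\frac{d}{d-1}$.
   Context: $\mathbb F_q$ is the finite field with $q$ elements, where $q$ is an odd prime power (the characteristic is greater than two), $\mathbb F_q^*=\mathbb F_q\setminus\{0\}$, and $\mathbb F_q^d$ is the $d$-dimensional vector space over $\mathbb F_q$. Norms are taken with respect to normalized counting measure: for $f:\mathbb F_q^d\to\mathbb C$ and $1\le s<\infty$, $$\|f\|_{L^s(\mathbb F_q^d)}=\Big(q^{-d}\sum_{x\in\mathbb F_q^d}|f(x)|^s\Big)^{1/s},\qquad \|f\|_{L^\infty(\mathbb F_q^d)}=\max_{x\in\mathbb F_q^d}|f(x)|.$$ The convolution of $f$ with the normalized surface measure $d\mu_j$ on $\Pi_j$ is the average $$f\ast d\mu_j(x)=\frac{1}{|\Pi_j|}\sum_{y\in\Pi_j}f(x-y),\qquad x\in\mathbb F_q^d,$$ where $|\Pi_j|$ is the cardinality of $\Pi_j$. The supremum over $j$ is taken pointwise in $x$. The constant $C$ may depend on $p$ and $d$.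 *)

theory Defs
  imports Complex_Main "HOL-Library.Extended_Real" "HOL-Library.FuncSet"
    "HOL-Algebra.Weak_Morphisms" "HOL-Number_Theory.Prime_Powers"
begin

text \<open>
  A constant that is uniform over all finite fields has to be chosen before the field, so the
  field cannot be a type: \<open>\<F>\<^sub>q\<close> is a field record of order \<open>q\<close> whose carrier is a set of integers.
  The lemma shows that this covers every finite field up to isomorphism.
\<close>

definition finite_field_of_order :: "nat \<Rightarrow> int ring \<Rightarrow> bool" where
  "finite_field_of_order q F \<longleftrightarrow> field F \<and> finite (carrier F) \<and> card (carrier F) = q"

lemma finite_field_of_order_exhaustive:
  fixes R :: "('a, 'b) ring_scheme"
  assumes R: "field R" and fin: "finite (carrier R)"
  shows "\<exists>F. finite_field_of_order (card (carrier R)) F \<and> (\<exists>h. h \<in> ring_iso R F)"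
proof -
  obtain g :: "'a \<Rightarrow> nat" where g: "inj_on g (carrier R)"
    using finite_imp_inj_to_nat_seg[OF fin] by blast
  define h where "h = int \<circ> g"
  have h: "inj_on h (carrier R)"
    using g by (auto simp: h_def inj_on_def)
  have "field (image_ring h R)"
    using field.inj_imp_image_ring_is_field[OF R h] .
  moreover have "card (carrier (image_ring h R)) = card (carrier R)"
    using h by (simp add: image_ring_carrier card_image)
  ultimately have "finite_field_of_order (card (carrier R)) (image_ring h R)"
    using fin by (simp add: finite_field_of_order_def image_ring_carrier)
  then show ?thesis
    using inj_imp_image_ring_iso[OF h] by blast
qed

text \<open>\<open>\<F>\<^sub>q\<^sup>d\<close> consists of the coordinate functions on \<open>{1..d}\<close>, extensional outside \<open>{1..d}\<close>.\<close>

definition vecs :: "int ring \<Rightarrow> nat \<Rightarrow> (nat \<Rightarrow> int) set" where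
  "vecs F d = {1..d} \<rightarrow>\<^sub>E carrier F"

definition vec_diff :: "int ring \<Rightarrow> nat \<Rightarrow> (nat \<Rightarrow> int) \<Rightarrow> (nat \<Rightarrow> int) \<Rightarrow> nat \<Rightarrow> int" where
  "vec_diff F d x y = (\<lambda>k\<in>{1..d}. x k \<ominus>\<^bsub>F\<^esub> y k)"

definition product_variety :: "int ring \<Rightarrow> nat \<Rightarrow> int \<Rightarrow> (nat \<Rightarrow> int) set" where
  "product_variety F d j = {x \<in> vecs F d. (\<Otimes>\<^bsub>F\<^esub>k\<in>{1..d}. x k) = j}"

definition surface_average ::
    "int ring \<Rightarrow> nat \<Rightarrow> int \<Rightarrow> ((nat \<Rightarrow> int) \<Rightarrow> complex) \<Rightarrow> (nat \<Rightarrow> int) \<Rightarrow> complex" where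
  "surface_average F d j f x =
     (\<Sum>y\<in>product_variety F d j. f (vec_diff F d x y)) / of_nat (card (product_variety F d j))"

definition maximal_function ::
    "int ring \<Rightarrow> nat \<Rightarrow> ((nat \<Rightarrow> int) \<Rightarrow> complex) \<Rightarrow> (nat \<Rightarrow> int) \<Rightarrow> real" where
  "maximal_function F d f x = (SUP j\<in>carrier F - {\<zero>\<^bsub>F\<^esub>}. norm (surface_average F d j f x))"

text \<open>
  The norm is for normalized counting measure on \<open>\<F>\<^sub>q\<^sup>d\<close>. It is meant for exponents in
  \<open>[1, \<infinity>]\<close>, so \<open>0 powr p = 0\<close> is the right value at zeros of the function.
\<close>

definition Lp_norm ::
    "int ring \<Rightarrow> nat \<Rightarrow> ereal \<Rightarrow> ((nat \<Rightarrow> int) \<Rightarrow> 'a::real_normed_vector) \<Rightarrow> real" where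
  "Lp_norm F d p f =
     (if p = \<infinity> then Max ((\<lambda>x. norm (f x)) ` vecs F d)
      else ((\<Sum>x\<in>vecs F d. norm (f x) powr real_of_ereal p) / real (card (carrier F)) ^ d)
             powr (1 / real_of_ereal p))"

end

theory Submission
  imports Defs "HOL-Analysis.L2_Norm" "HOL-Analysis.Convex" "HOL-Number_Theory.Residues"
begin

text \<open>
  Necessity: the point mass at the origin has \<open>sup\<^sub>j |f * d\<mu>\<^sub>j| = (q - 1)\<^sup>-\<^sup>(\<^sup>d\<^sup>-\<^sup>1\<^sup>)\<close> at the points all of whose
  coordinates are nonzero.

  Sufficiency: since the \<open>f * d\<mu>\<^sub>j\<close> are averages, Jensen's inequality reduces every finite \<open>p\<close> to the
  endpoint \<open>d/(d-1)\<close>. Let \<open>\<nu>\<close> be the mean of the \<open>\<mu>\<^sub>j\<close>, a probability measure, and bound the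
  supremum of \<open>|f * (\<mu>\<^sub>j - \<nu>)|\<close> by the square function in \<open>j\<close>. Its \<open>L\<^sup>1\<close> norm is trivially at most
  \<open>2(q - 1)\<close> times that of \<open>f\<close>. For \<open>L\<^sup>2\<close> one counts, for given \<open>a\<close> and \<open>b\<close>, the \<open>x\<close> with
  \<open>\<Prod>(x\<^sub>k - a\<^sub>k) = \<Prod>(x\<^sub>k - b\<^sub>k) \<noteq> 0\<close>; the deviation from the expected number is
  \<open>(q - 2)/(q - 1)\<close> times the kernel of the tensor power of \<open>q I - J\<close>, whose norm is \<open>q\<^sup>d\<close>. So neither
  characters nor bounds for Kloosterman sums are needed. Real interpolation between the two estimates
  gives the endpoint bound without loss in \<open>q\<close>.
\<close>

subsection \<open>Dyadic interpolation\<close>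

text \<open>Jensen's inequality for the power \<open>p\<close>. Young's inequality bounds
  \<open>m powr (p - 1) * u a\<close> with \<open>m\<close> the mean of \<open>u\<close>, so the
  convex function is compared with its tangent at \<open>m\<close>; summing over \<open>A\<close>
  turns the left side into \<open>card A * m powr p\<close>.\<close>

lemma powr_sum_average_le:
  fixes u :: "'a \<Rightarrow> real"
  assumes A: "finite A" "A \<noteq> {}" and p: "p \<ge> 1" and u: "\<And>a. a \<in> A \<Longrightarrow> u a \<ge> 0"
  shows "((\<Sum>a\<in>A. u a) / card A) powr p \<le> (\<Sum>a\<in>A. u a powr p) / card A"
proof (cases "(\<Sum>a\<in>A. u a) = 0")
  case True
  then show ?thesis by (simp add: sum_nonneg)
next
  case False
  define m where "m = (\<Sum>a\<in>A. u a) / card A"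
  have n: "real (card A) > 0" using A by (simp add: card_gt_0_iff)
  have "(\<Sum>a\<in>A. u a) \<ge> 0" using u by (rule sum_nonneg)
  then have "(\<Sum>a\<in>A. u a) > 0" using False by linarith
  then have m: "m > 0" using n by (simp add: m_def)
  have young: "m powr (p - 1) * u a \<le> (1 - 1/p) * m powr p + u a powr p / p" if "a \<in> A" for a
  proof (cases "u a = 0")
    case True
    then show ?thesis using p by simp
  next
    case False
    then have "u a > 0" using u[OF that] by simp
    then have "(m powr p) powr (1 - 1/p) * (u a powr p) powr (1/p)
        \<le> (1 - 1/p) * m powr p + (1/p) * u a powr p"
      using p m by (intro Youngs_inequality_0) auto
    moreover have "p * (1 - 1/p) = p - 1" using p by (simp add: field_simps)
    ultimately show ?thesis using p \<open>u a > 0\<close> by (simp add: powr_powr)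
  qed
  have "card A * m powr p = m powr (p - 1) * (m * card A)"
    using m by (simp add: powr_diff)
  also have "\<dots> = (\<Sum>a\<in>A. m powr (p - 1) * u a)"
    using n by (simp add: m_def sum_distrib_left)
  also have "\<dots> \<le> (\<Sum>a\<in>A. (1 - 1/p) * m powr p + u a powr p / p)"
    by (intro sum_mono young)
  also have "\<dots> = card A * m powr p - card A * m powr p / p + (\<Sum>a\<in>A. u a powr p) / p"
    by (simp only: sum.distrib sum_constant sum_divide_distrib) (simp add: algebra_simps)
  finally have "card A * m powr p / p \<le> (\<Sum>a\<in>A. u a powr p) / p" by simp
  then have "card A * m powr p \<le> (\<Sum>a\<in>A. u a powr p)"
    using p by (simp add: field_simps)
  then show ?thesis using n by (simp add: m_def[symmetric] field_simps)
qed

text \<open>The exponents in \<open>L\<close> are distinct integers not exceeding the floor of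
  \<open>log 2 u\<close>, so the sum is dominated by a geometric series of ratio
  \<open>2 powr (-r)\<close> descending from a top term of at most \<open>u powr r\<close>. Gaps in
  \<open>L\<close> do no harm because all terms are positive.\<close>

lemma sum_dyadic_powr_le:
  fixes L :: "int set"
  assumes L: "finite L" and u: "\<And>l. l \<in> L \<Longrightarrow> 2 powr real_of_int l \<le> u" and pos: "u > 0" "r > 0"
  shows "(\<Sum>l\<in>L. 2 powr (r * real_of_int l)) \<le> u powr r / (1 - 2 powr (-r))"
proof -
  define m where "m = \<lfloor>log 2 u\<rfloor>"
  have le: "l \<le> m" if "l \<in> L" for l
    using u[OF that] pos by (simp add: m_def le_floor_iff le_log_iff)
  define t where "t = (2::real) powr (-r)"
  have t: "0 < t" "t < 1" using pos by (auto simp: t_def powr_less_one)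
  have "2 powr (r * real_of_int l) = 2 powr (r * m) * t ^ nat (m - l)" if "l \<in> L" for l
  proof -
    have "t ^ nat (m - l) = 2 powr (-r * real (nat (m - l)))"
      by (simp add: t_def powr_realpow[symmetric] powr_powr)
    also have "real (nat (m - l)) = real_of_int m - real_of_int l" using le[OF that] by simp
    finally show ?thesis by (simp add: powr_add[symmetric] algebra_simps)
  qed
  then have "(\<Sum>l\<in>L. 2 powr (r * real_of_int l)) = (\<Sum>l\<in>L. 2 powr (r * m) * t ^ nat (m - l))"
    by simp
  also have "\<dots> = 2 powr (r * m) * (\<Sum>n\<in>(\<lambda>l. nat (m - l)) ` L. t ^ n)"
  proof -
    have "inj_on (\<lambda>l. nat (m - l)) L"
    proof (rule inj_onI)
      fix k l assume "k \<in> L" "l \<in> L" "nat (m - k) = nat (m - l)"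
      then show "k = l" using le[of k] le[of l] by linarith
    qed
    then show ?thesis by (simp add: sum.reindex sum_distrib_left)
  qed
  also have "\<dots> \<le> 2 powr (r * m) * (\<Sum>n. t ^ n)"
    using t L by (intro mult_left_mono sum_le_suminf summable_geometric) auto
  also have "\<dots> = 2 powr (r * m) / (1 - t)"
    using t by (simp add: suminf_geometric)
  also have "\<dots> \<le> u powr r / (1 - t)"
  proof (intro divide_right_mono)
    have "r * m \<le> r * log 2 u" using pos by (simp add: m_def)
    then have "2 powr (r * m) \<le> 2 powr (log 2 u * r)" by (simp add: mult.commute)
    also have "\<dots> = u powr r" using pos by (simp add: powr_powr[symmetric])
    finally show "2 powr (r * m) \<le> u powr r" .
  qed (use t in auto)
  finally show ?thesis by (simp add: t_def)
qed

text \<open>The two summands come from the L1 and the L2 half of the interpolation. Their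
  denominators are those of geometric series with ratios \<open>2 powr (1 - p)\<close> and
  \<open>2 powr (p - 2)\<close>, which degenerate at \<open>p = 1\<close> and \<open>p = 2\<close>
  respectively.\<close>

definition interpolation_const :: "real \<Rightarrow> real" where
  "interpolation_const p =
     2 powr p * (2 / (1 - 2 powr (1 - p)) + 4 / (1 - 2 powr (p - 2)))"

text \<open>
  The exponent \<open>p\<close> is strictly between the endpoints, so that both dyadic sums are geometric
  and the bound is of strong type.
\<close>

lemma sublinear_interpolation:
  fixes T :: "('a \<Rightarrow> real) \<Rightarrow> 'a \<Rightarrow> real"
  assumes X: "finite X" and p: "1 < p" "p < 2" and A: "A1 > 0" "A2 > 0"
    and nonneg: "\<And>g x. x \<in> X \<Longrightarrow> 0 \<le> T g x"
    and subadd: "\<And>g h x. x \<in> X \<Longrightarrow> T (\<lambda>y. g y + h y) x \<le> T g x + T h x"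
    and L1: "\<And>g. (\<And>x. x \<in> X \<Longrightarrow> 0 \<le> g x) \<Longrightarrow> (\<Sum>x\<in>X. T g x) \<le> A1 * (\<Sum>x\<in>X. g x)"
    and L2: "\<And>g. (\<And>x. x \<in> X \<Longrightarrow> 0 \<le> g x) \<Longrightarrow> (\<Sum>x\<in>X. (T g x)\<^sup>2) \<le> A2 * (\<Sum>x\<in>X. (g x)\<^sup>2)"
    and f: "\<And>x. x \<in> X \<Longrightarrow> 0 \<le> f x"
  shows "(\<Sum>x\<in>X. T f x powr p)
      \<le> interpolation_const p * A1 powr (2 - p) * A2 powr (p - 1) * (\<Sum>x\<in>X. f x powr p)"
proof -
  \<comment> \<open>At level \<open>l\<close> the function \<open>f\<close> is cut at height
    \<open>B * 2 powr l\<close>. This \<open>B\<close> is the one value for which the large part,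
    \<open>A1 / B powr (p - 1)\<close>, and the small part, \<open>A2 * B powr (2 - p)\<close>,
    contribute the same constant.\<close>
  define B where "B = A1 / A2"
  have B: "B > 0" using A by (simp add: B_def)
  define hi lo :: "int \<Rightarrow> 'a \<Rightarrow> real" where
    "hi = (\<lambda>l y. if f y > B * 2 powr l then f y else 0)" and
    "lo = (\<lambda>l y. if f y > B * 2 powr l then 0 else f y)"
  \<comment> \<open>The dyadic level of \<open>T f x\<close>. Points with \<open>T f x = 0\<close>
    contribute nothing, and the finitely many other points occupy finitely many levels, so all sums
    over levels are finite.\<close>
  define lev where "lev x = \<lfloor>log 2 (T f x)\<rfloor>" for x
  define L where "L = lev ` {x \<in> X. T f x > 0}"
  have L: "finite L" using X by (simp add: L_def)
  \<comment> \<open>Chebyshev weights: with \<open>s = 2 powr l\<close> these are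
    \<open>(2 * s) powr p * 2 / s\<close> and \<open>(2 * s) powr p * 4 / s\<^sup>2\<close>, the
    costs of exceeding \<open>s / 2\<close> in L1 and in L2.\<close>
  define a b :: "int \<Rightarrow> real" where
    "a = (\<lambda>l. 2 powr p * (2 * 2 powr ((p - 1) * l)))" and
    "b = (\<lambda>l. 2 powr p * (4 * 2 powr ((2 - p) * -l)))"
  have ab: "a l \<ge> 0" "b l \<ge> 0" for l by (auto simp: a_def b_def)
  have split: "T f x powr p \<le> (\<Sum>l\<in>L. a l * T (hi l) x + b l * (T (lo l) x)\<^sup>2)" if x: "x \<in> X" for x
  proof (cases "T f x > 0")
    case False
    then have "T f x = 0" using nonneg[OF x, of f] by simp
    then show ?thesis using nonneg[OF x] ab by (auto intro!: sum_nonneg)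
  next
    case True
    define l where "l = lev x"
    define s where "s = 2 powr real_of_int l"
    have s: "s > 0" by (simp add: s_def)
    have l: "l \<in> L" using x True by (auto simp: l_def L_def)
    have l_le: "s \<le> T f x"
      using True by (simp add: le_log_iff[symmetric] l_def lev_def s_def)
    have "log 2 (T f x) < l + 1" by (simp add: l_def lev_def)
    then have less_l: "T f x < 2 * s" using True by (simp add: log_less_iff powr_add s_def)
    have "f = (\<lambda>y. hi l y + lo l y)" by (auto simp: hi_def lo_def)
    then have sp: "s \<le> T (hi l) x + T (lo l) x" using subadd[OF x, of "hi l" "lo l"] l_le by simp
    \<comment> \<open>The two parts add up to at least \<open>s\<close>, so one of them reaches
      \<open>s / 2\<close> and its term alone is at least 1.\<close>
    have "1 \<le> 2 * T (hi l) x / s + 4 * (T (lo l) x)\<^sup>2 / s\<^sup>2"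
    proof (cases "T (hi l) x \<ge> s / 2")
      case True
      then have "2 * T (hi l) x / s \<ge> 1" using s by (simp add: field_simps)
      then show ?thesis by (simp add: add_increasing2)
    next
      case False
      then have "T (lo l) x \<ge> s / 2" using sp by simp
      then have "(T (lo l) x)\<^sup>2 \<ge> (s/2)\<^sup>2" using s by (intro power_mono) auto
      then have "4 * (T (lo l) x)\<^sup>2 / s\<^sup>2 \<ge> 1" using s by (simp add: field_simps)
      then show ?thesis using nonneg[OF x] s by (simp add: add_increasing)
    qed
    then have "(2 * s) powr p * 1 \<le> (2 * s) powr p * (2 * T (hi l) x / s + 4 * (T (lo l) x)\<^sup>2 / s\<^sup>2)"
      by (intro mult_left_mono) auto
    also have "\<dots> = a l * T (hi l) x + b l * (T (lo l) x)\<^sup>2"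
    proof -
      have sp: "(2 * s) powr p = 2 powr p * s powr p" using s by (simp add: powr_mult)
      have "2 powr ((p - 1) * l) = s powr (p - 1)" by (simp add: s_def powr_powr mult.commute)
      also have "\<dots> = s powr p / s" using s by (simp add: powr_diff)
      finally have 1: "a l = (2 * s) powr p * 2 / s" by (simp add: a_def sp)
      have "2 powr ((2 - p) * -l) = s powr (p - 2)"
        by (simp add: s_def powr_powr algebra_simps)
      also have "\<dots> = s powr p / s\<^sup>2" using s powr_realpow[of s 2] by (simp add: powr_diff)
      finally have 2: "b l = (2 * s) powr p * 4 / s\<^sup>2" by (simp add: b_def sp)
      show ?thesis unfolding 1 2 by (simp add: algebra_simps)
    qed
    also have "\<dots> \<le> (\<Sum>l\<in>L. a l * T (hi l) x + b l * (T (lo l) x)\<^sup>2)"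
      using l L nonneg[OF x] ab
      by (intro member_le_sum[of l L "\<lambda>l. a l * T (hi l) x + b l * (T (lo l) x)\<^sup>2"]) auto
    finally show ?thesis using less_l True p powr_mono2[of p "T f x" "2 * s"] by auto
  qed
  define ca cb where "ca = 2 powr p * 2 / (1 - 2 powr (1 - p))" and
    "cb = 2 powr p * 4 / (1 - 2 powr (p - 2))"
  define N where "N = A1 powr (2 - p) * A2 powr (p - 1)"
  have B1: "A1 / B powr (p - 1) = N"
  proof -
    have "A1 / B powr (p - 1) = A1 / A1 powr (p - 1) * A2 powr (p - 1)"
      using A by (simp add: B_def powr_divide)
    also have "A1 / A1 powr (p - 1) = A1 powr (2 - p)"
      using A powr_diff[of A1 1 "p - 1"] by simp
    finally show ?thesis by (simp add: N_def)
  qed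
  have B2: "A2 * B powr (2 - p) = N"
  proof -
    have "A2 * B powr (2 - p) = A1 powr (2 - p) * (A2 / A2 powr (2 - p))"
      using A by (simp add: B_def powr_divide)
    also have "A2 / A2 powr (2 - p) = A2 powr (p - 1)"
      using A powr_diff[of A2 1 "2 - p"] by simp
    finally show ?thesis by (simp add: N_def)
  qed
  \<comment> \<open>For fixed \<open>y\<close> only the levels with
    \<open>2 powr l < f y / B\<close> see \<open>y\<close> in the large part. The weights grow with
    \<open>l\<close> because \<open>p > 1\<close>, so the highest of these levels dominates.\<close>
  have high: "(\<Sum>l\<in>L. a l * hi l y) * A1 \<le> ca * N * f y powr p" if y: "y \<in> X" for y
  proof (cases "f y = 0")
    case True
    then have "hi l y = 0" for l by (simp add: hi_def)
    then show ?thesis using True by simp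
  next
    case False
    then have fy: "f y > 0" using f[OF y] by simp
    define M where "M = {l \<in> L. f y > B * 2 powr l}"
    have "(\<Sum>l\<in>L. a l * hi l y) = (\<Sum>l\<in>M. a l * f y)"
      using L by (intro sum.mono_neutral_cong_right) (auto simp: M_def hi_def)
    also have "\<dots> = 2 powr p * 2 * f y * (\<Sum>l\<in>M. 2 powr ((p - 1) * l))"
      by (simp add: a_def sum_distrib_left mult_ac)
    also have "(\<Sum>l\<in>M. 2 powr ((p - 1) * l)) \<le> (f y / B) powr (p - 1) / (1 - 2 powr (- (p - 1)))"
      using L fy B p by (intro sum_dyadic_powr_le) (auto simp: M_def field_simps)
    finally have "(\<Sum>l\<in>L. a l * hi l y) \<le> ca * (f y * (f y / B) powr (p - 1))"
      using fy by (simp add: ca_def mult_left_mono mult_ac)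
    also have "f y * (f y / B) powr (p - 1) = f y powr p / B powr (p - 1)"
      using fy B powr_diff[of "f y" p 1] by (simp add: powr_divide)
    finally have "(\<Sum>l\<in>L. a l * hi l y) * A1 \<le> ca * (f y powr p / B powr (p - 1)) * A1"
      using A by (intro mult_right_mono) auto
    also have "\<dots> = ca * (A1 / B powr (p - 1)) * f y powr p" by simp
    finally show ?thesis by (simp only: B1)
  qed
  \<comment> \<open>Here the levels satisfy \<open>2 powr l \<ge> f y / B\<close> and the weights
    decay with \<open>l\<close> because \<open>p < 2\<close>. After the change of sign of
    \<open>l\<close> the levels are bounded above, with \<open>2 powr l \<le> B / f y\<close>, and
    the same geometric bound applies.\<close>
  have low: "(\<Sum>l\<in>L. b l * (lo l y)\<^sup>2) * A2 \<le> cb * N * f y powr p" if y: "y \<in> X" for y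
  proof (cases "f y = 0")
    case True
    then have "lo l y = 0" for l by (simp add: lo_def)
    then show ?thesis using True by simp
  next
    case False
    then have fy: "f y > 0" using f[OF y] by simp
    define M where "M = {l \<in> L. \<not> f y > B * 2 powr l}"
    have "(\<Sum>l\<in>L. b l * (lo l y)\<^sup>2) = (\<Sum>l\<in>M. b l * (f y)\<^sup>2)"
      using L by (intro sum.mono_neutral_cong_right) (auto simp: M_def lo_def)
    also have "\<dots> = 2 powr p * 4 * (f y)\<^sup>2 * (\<Sum>l\<in>M. 2 powr ((2 - p) * real_of_int (-l)))"
      by (simp add: b_def sum_distrib_left mult_ac)
    also have "(\<Sum>l\<in>M. 2 powr ((2 - p) * real_of_int (-l)))
        = (\<Sum>l\<in>uminus ` M. 2 powr ((2 - p) * real_of_int l))"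
      by (simp add: sum.reindex)
    also have "\<dots> \<le> (B / f y) powr (2 - p) / (1 - 2 powr (- (2 - p)))"
      using L fy B p
      by (intro sum_dyadic_powr_le) (auto simp: M_def powr_minus field_simps)
    finally have "(\<Sum>l\<in>L. b l * (lo l y)\<^sup>2) \<le> cb * ((f y)\<^sup>2 * (B / f y) powr (2 - p))"
      using fy by (simp add: cb_def mult_left_mono mult_ac)
    also have "(f y)\<^sup>2 * (B / f y) powr (2 - p) = f y powr p * B powr (2 - p)"
    proof -
      have "(f y)\<^sup>2 = f y powr 2" using fy by simp
      then have "(f y)\<^sup>2 * (B / f y) powr (2 - p) = (f y powr 2 / f y powr (2 - p)) * B powr (2 - p)"
        using fy B by (simp add: powr_divide)
      also have "f y powr 2 / f y powr (2 - p) = f y powr p"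
        by (simp add: powr_diff[symmetric])
      finally show ?thesis .
    qed
    finally have "(\<Sum>l\<in>L. b l * (lo l y)\<^sup>2) * A2 \<le> cb * (f y powr p * B powr (2 - p)) * A2"
      using A by (intro mult_right_mono) auto
    also have "\<dots> = cb * (A2 * B powr (2 - p)) * f y powr p" by simp
    finally show ?thesis by (simp only: B2)
  qed
  have "(\<Sum>x\<in>X. T f x powr p) \<le> (\<Sum>x\<in>X. \<Sum>l\<in>L. a l * T (hi l) x + b l * (T (lo l) x)\<^sup>2)"
    by (intro sum_mono split)
  also have "\<dots> = (\<Sum>l\<in>L. a l * (\<Sum>x\<in>X. T (hi l) x) + b l * (\<Sum>x\<in>X. (T (lo l) x)\<^sup>2))"
    by (subst sum.swap) (simp add: sum.distrib sum_distrib_left)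
  also have "\<dots> \<le> (\<Sum>l\<in>L. a l * (A1 * (\<Sum>y\<in>X. hi l y)) + b l * (A2 * (\<Sum>y\<in>X. (lo l y)\<^sup>2)))"
    using ab f by (intro sum_mono add_mono mult_left_mono L1 L2) (auto simp: hi_def lo_def)
  also have "\<dots> = (\<Sum>l\<in>L. \<Sum>y\<in>X. a l * hi l y * A1 + b l * (lo l y)\<^sup>2 * A2)"
    by (simp add: sum.distrib sum_distrib_left mult_ac)
  also have "\<dots> = (\<Sum>y\<in>X. (\<Sum>l\<in>L. a l * hi l y) * A1 + (\<Sum>l\<in>L. b l * (lo l y)\<^sup>2) * A2)"
    by (subst sum.swap) (simp add: sum.distrib sum_distrib_right)
  also have "\<dots> \<le> (\<Sum>y\<in>X. ca * N * f y powr p + cb * N * f y powr p)"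
    by (intro sum_mono add_mono high low)
  also have "\<dots> = (ca + cb) * N * (\<Sum>y\<in>X. f y powr p)"
    by (simp add: sum.distrib sum_distrib_left algebra_simps)
  also have "ca + cb = interpolation_const p"
    by (simp add: ca_def cb_def interpolation_const_def algebra_simps)
  finally show ?thesis by (simp add: N_def mult_ac)
qed

subsection \<open>A tensor power of a projection\<close>

lemma sum_PiE_insert:
  fixes g :: "('a \<Rightarrow> 'b) \<Rightarrow> 'c::comm_monoid_add"
  assumes "i \<notin> I"
  shows "(\<Sum>x\<in>insert i I \<rightarrow>\<^sub>E A. g x) = (\<Sum>c\<in>A. \<Sum>x\<in>I \<rightarrow>\<^sub>E A. g (x(i := c)))"
proof -
  have "(\<Sum>x\<in>insert i I \<rightarrow>\<^sub>E A. g x) = (\<Sum>z\<in>A \<times> (I \<rightarrow>\<^sub>E A). g ((\<lambda>(c, x). x(i := c)) z))"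
    unfolding PiE_insert_eq by (subst sum.reindex) (use inj_combinator[OF assms] in \<open>auto simp: o_def\<close>)
  also have "\<dots> = (\<Sum>c\<in>A. \<Sum>x\<in>I \<rightarrow>\<^sub>E A. g (x(i := c)))"
    by (simp add: sum.cartesian_product case_prod_beta)
  finally show ?thesis .
qed

definition tensor_kernel :: "real \<Rightarrow> 'i set \<Rightarrow> ('i \<Rightarrow> 'b) \<Rightarrow> ('i \<Rightarrow> 'b) \<Rightarrow> real" where
  "tensor_kernel q I a b = (\<Prod>k\<in>I. (if a k = b k then q else 0) - 1)"

text \<open>
  With \<open>J\<close> the all-ones matrix, \<open>q\<^sup>-\<^sup>1 (q I - J)\<close> is an orthogonal projection, hence so are its
  tensor powers.
\<close>

lemma tensor_kernel_compose:
  assumes A: "finite A" and I: "finite I" and q: "q = real (card A)"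
    and a: "a \<in> I \<rightarrow>\<^sub>E A" and b: "b \<in> I \<rightarrow>\<^sub>E A"
  shows "(\<Sum>z\<in>I \<rightarrow>\<^sub>E A. tensor_kernel q I a z * tensor_kernel q I b z) = q ^ card I * tensor_kernel q I a b"
proof -
  have one: "(\<Sum>z\<in>A. ((if s = z then q else 0) - 1) * ((if t = z then q else 0) - 1))
      = q * ((if s = t then q else 0) - 1)" if "s \<in> A" "t \<in> A" for s t
  proof -
    \<comment> \<open>The product is regrouped so that the bracket with \<open>t\<close> sums to
      zero, as \<open>q\<close> is the number of elements of \<open>A\<close>, while the bracket
      with \<open>s\<close> is supported at \<open>z = s\<close>.\<close>
    have "(\<Sum>z\<in>A. ((if s = z then q else 0) - 1) * ((if t = z then q else 0) - 1))
        = (\<Sum>z\<in>A. (if s = z then (if s = t then q * q else 0) - q else 0) + (1 - (if t = z then q else 0)))"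
      by (intro sum.cong) (auto simp: algebra_simps)
    also have "\<dots> = (if s = t then q * q else 0) - q"
      using A that by (simp add: sum.distrib sum_subtractf q)
    finally show ?thesis by (simp add: algebra_simps)
  qed
  have "(\<Sum>z\<in>I \<rightarrow>\<^sub>E A. tensor_kernel q I a z * tensor_kernel q I b z)
      = (\<Prod>k\<in>I. \<Sum>z\<in>A. ((if a k = z then q else 0) - 1) * ((if b k = z then q else 0) - 1))"
    using A I by (simp add: prod_sum_PiE tensor_kernel_def prod.distrib)
  also have "\<dots> = (\<Prod>k\<in>I. q * ((if a k = b k then q else 0) - 1))"
    using a b by (intro prod.cong one) auto
  finally show ?thesis by (simp add: tensor_kernel_def prod.distrib)
qed

text \<open>Let \<open>M\<close> be the symmetric kernel matrix and \<open>N = q ^ card I\<close>.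
  Since \<open>M\<close> squared is \<open>N * M\<close>, expanding the nonnegative squared norm of
  \<open>N f - M f\<close> gives \<open>N\<close> squared times the squared norm of
  \<open>f\<close>, minus \<open>N\<close> times the quadratic form.\<close>

lemma tensor_kernel_quadratic_form_le:
  assumes A: "finite A" "A \<noteq> {}" and I: "finite I" and q: "q = real (card A)"
  shows "(\<Sum>a\<in>I \<rightarrow>\<^sub>E A. \<Sum>b\<in>I \<rightarrow>\<^sub>E A. f a * f b * tensor_kernel q I a b)
      \<le> q ^ card I * (\<Sum>a\<in>I \<rightarrow>\<^sub>E A. (f a)\<^sup>2)"
proof -
  define V where "V = I \<rightarrow>\<^sub>E A"
  define Q where "Q = (\<Sum>a\<in>V. \<Sum>b\<in>V. f a * f b * tensor_kernel q I a b)"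
  define N where "N = q ^ card I"
  have "q > 0" using A by (simp add: q card_gt_0_iff)
  then have N: "N > 0" by (simp add: N_def)
  define g where "g z = (\<Sum>a\<in>V. f a * tensor_kernel q I a z)" for z
  have fg: "(\<Sum>z\<in>V. f z * g z) = Q"
    unfolding Q_def g_def by (subst sum.swap) (simp add: sum_distrib_left mult_ac)
  have "(\<Sum>z\<in>V. (g z)\<^sup>2)
      = (\<Sum>z\<in>V. \<Sum>a\<in>V. \<Sum>b\<in>V. f a * f b * (tensor_kernel q I a z * tensor_kernel q I b z))"
    unfolding g_def power2_eq_square sum_product by (simp add: mult_ac)
  also have "\<dots> = (\<Sum>a\<in>V. \<Sum>b\<in>V. \<Sum>z\<in>V. f a * f b * (tensor_kernel q I a z * tensor_kernel q I b z))"
    by (subst sum.swap, rule sum.cong[OF refl], rule sum.swap)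
  also have "\<dots> = (\<Sum>a\<in>V. \<Sum>b\<in>V. f a * f b * (N * tensor_kernel q I a b))"
    unfolding sum_distrib_left[symmetric] V_def N_def
    by (intro sum.cong refl) (simp add: tensor_kernel_compose[OF A(1) I q])
  also have "\<dots> = N * Q"
    unfolding Q_def by (simp add: sum_distrib_left mult_ac)
  finally have gg: "(\<Sum>z\<in>V. (g z)\<^sup>2) = N * Q" .
  have "0 \<le> (\<Sum>z\<in>V. (N * f z - g z)\<^sup>2)"
    by (intro sum_nonneg) auto
  also have "\<dots> = (\<Sum>z\<in>V. N\<^sup>2 * (f z)\<^sup>2 - 2 * N * (f z * g z) + (g z)\<^sup>2)"
    by (intro sum.cong refl) (simp add: power2_eq_square algebra_simps)
  also have "\<dots> = N\<^sup>2 * (\<Sum>z\<in>V. (f z)\<^sup>2) - 2 * N * Q + N * Q"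
    by (simp add: sum.distrib sum_subtractf sum_distrib_left[symmetric] fg gg)
  finally have "N * Q \<le> N * (N * (\<Sum>z\<in>V. (f z)\<^sup>2))"
    by (simp add: power2_eq_square)
  then show ?thesis using N unfolding Q_def V_def N_def by simp
qed

subsection \<open>Counting over a finite field\<close>

locale finite_field = field F for F :: "int ring" (structure) +
  assumes finite_carrier: "finite (carrier F)"
begin

abbreviation q :: real where "q \<equiv> real (card (carrier F))"

abbreviation space :: "nat set \<Rightarrow> (nat \<Rightarrow> int) set" where "space I \<equiv> I \<rightarrow>\<^sub>E carrier F"

abbreviation units :: "int set" where "units \<equiv> carrier F - {\<zero>}"

text \<open>The index set is arbitrary rather than \<open>{1..d}\<close> so that the counts below
  can proceed by induction on the set of coordinates.\<close>

definition diff_prod :: "nat set \<Rightarrow> (nat \<Rightarrow> int) \<Rightarrow> (nat \<Rightarrow> int) \<Rightarrow> int" where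
  "diff_prod I x a = (\<Otimes>k\<in>I. x k \<ominus> a k)"

lemma finite_space [simp]: "finite I \<Longrightarrow> finite (space I)"
  using finite_carrier by (simp add: finite_PiE)

lemma q_ge_2: "q \<ge> 2"
proof -
  have "card {\<zero>, \<one>} \<le> card (carrier F)"
    using finite_carrier by (intro card_mono) auto
  then show ?thesis by simp
qed

lemma card_units: "real (card units) = q - 1"
  using finite_carrier q_ge_2 by (simp add: card_Diff_singleton of_nat_diff)

lemma of_nat_card_minus_1: "real (card (carrier F) - Suc 0) = q - 1"
  using q_ge_2 by (simp add: of_nat_diff)

lemma diff_eq_zero_iff:
  assumes "x \<in> carrier F" "y \<in> carrier F"
  shows "x \<ominus> y = \<zero> \<longleftrightarrow> x = y"
  using assms r_right_minus_eq by blast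

lemma diff_prod_closed:
  assumes "x \<in> space I" "a \<in> I \<rightarrow> carrier F"
  shows "diff_prod I x a \<in> carrier F"
  using assms unfolding diff_prod_def by (intro finprod_closed) auto

lemma diff_prod_insert:
  assumes "finite I" "i \<notin> I" "x \<in> space I" "c \<in> carrier F" "a \<in> insert i I \<rightarrow> carrier F"
  shows "diff_prod (insert i I) (x(i := c)) a = (c \<ominus> a i) \<otimes> diff_prod I x a"
proof -
  have "diff_prod (insert i I) (x(i := c)) a = ((x(i := c)) i \<ominus> a i) \<otimes> (\<Otimes>k\<in>I. (x(i := c)) k \<ominus> a k)"
    unfolding diff_prod_def using assms by (intro finprod_insert) (auto simp: Pi_iff)
  also have "(\<Otimes>k\<in>I. (x(i := c)) k \<ominus> a k) = diff_prod I x a"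
    unfolding diff_prod_def using assms by (intro finprod_cong') (auto simp: Pi_iff)
  finally show ?thesis by (simp only: fun_upd_same)
qed

lemma finprod_eq_zero_iff:
  assumes "finite I" "f \<in> I \<rightarrow> carrier F"
  shows "(\<Otimes>k\<in>I. f k) = \<zero> \<longleftrightarrow> (\<exists>k\<in>I. f k = \<zero>)"
  using assms by (induction I rule: finite_induct) (auto simp: integral_iff)

lemma diff_prod_eq_zero_iff:
  assumes "finite I" "x \<in> space I" "a \<in> I \<rightarrow> carrier F"
  shows "diff_prod I x a = \<zero> \<longleftrightarrow> (\<exists>k\<in>I. x k = a k)"
proof -
  have "diff_prod I x a = \<zero> \<longleftrightarrow> (\<exists>k\<in>I. x k \<ominus> a k = \<zero>)"
    unfolding diff_prod_def using assms by (intro finprod_eq_zero_iff) auto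
  also have "\<dots> \<longleftrightarrow> (\<exists>k\<in>I. x k = a k)"
    using assms by (intro bex_cong refl diff_eq_zero_iff) auto
  finally show ?thesis .
qed

lemma inv_closed_unit: "u \<in> units \<Longrightarrow> inv u \<in> units"
  using field_Units by (metis Units_inv_Units)

lemma mult_closed_unit: "u \<in> units \<Longrightarrow> v \<in> units \<Longrightarrow> u \<otimes> v \<in> units"
  using field_Units by (metis Units_m_closed)

lemma mult_eq_iff:
  assumes "u \<in> units" "x \<in> carrier F" "y \<in> carrier F"
  shows "u \<otimes> x = y \<longleftrightarrow> x = inv u \<otimes> y"
proof -
  have u: "u \<in> Units F" "u \<in> carrier F" using assms field_Units by auto
  then have "inv u \<otimes> (u \<otimes> x) = x" "u \<otimes> (inv u \<otimes> y) = y"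
    using assms by (simp_all add: m_assoc[symmetric])
  then show ?thesis by auto
qed

section \<open>Counting points at which two shifted products have a given ratio\<close>

text \<open>A Moebius transformation sending \<open>b\<close>, \<open>a\<close> and \<open>\<infinity>\<close> to \<open>0\<close>, \<open>\<infinity>\<close> and \<open>1\<close>.\<close>

lemma bij_betw_ratio:
  assumes a: "a \<in> carrier F" and b: "b \<in> carrier F" and ab: "a \<noteq> b"
  shows "bij_betw (\<lambda>c. (c \<ominus> b) \<otimes> inv (c \<ominus> a)) (carrier F - {a, b}) (carrier F - {\<zero>, \<one>})"
proof -
  define r where "r c = (c \<ominus> b) \<otimes> inv (c \<ominus> a)" for c
  \<comment> \<open>In this form injectivity and \<open>r c \<noteq> \<one>\<close> are visible,
    since the second summand is a unit determined by, and determining, \<open>c\<close>.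
    Surjectivity then follows because domain and target both have \<open>q - 2\<close>
    elements.\<close>
  have r: "r c = \<one> \<oplus> (a \<ominus> b) \<otimes> inv (c \<ominus> a)"
    and inv: "c \<ominus> a \<in> units" "inv (c \<ominus> a) \<in> units" if c: "c \<in> carrier F - {a, b}" for c
  proof -
    show u: "c \<ominus> a \<in> units" using c a by (auto simp: diff_eq_zero_iff)
    show i: "inv (c \<ominus> a) \<in> units" by (rule inv_closed_unit[OF u])
    have "c \<in> carrier F" using c by simp
    then have "c \<ominus> b = (c \<ominus> a) \<oplus> (a \<ominus> b)"
      using a b by (simp add: a_minus_def a_assoc r_neg1)
    then have "r c = (c \<ominus> a) \<otimes> inv (c \<ominus> a) \<oplus> (a \<ominus> b) \<otimes> inv (c \<ominus> a)"
      using i a b c by (simp add: r_def l_distr)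
    then show "r c = \<one> \<oplus> (a \<ominus> b) \<otimes> inv (c \<ominus> a)"
      using u field_Units by simp
  qed
  have ab': "a \<ominus> b \<in> units" using ab a b by (auto simp: diff_eq_zero_iff)
  have inj: "inj_on r (carrier F - {a, b})"
  proof (rule inj_onI)
    fix c c' assume c: "c \<in> carrier F - {a, b}" "c' \<in> carrier F - {a, b}" and eq: "r c = r c'"
    have cl: "(a \<ominus> b) \<otimes> inv (c \<ominus> a) \<in> carrier F" "(a \<ominus> b) \<otimes> inv (c' \<ominus> a) \<in> carrier F"
      using inv(2)[OF c(1)] inv(2)[OF c(2)] a b by auto
    from eq have "\<one> \<oplus> (a \<ominus> b) \<otimes> inv (c \<ominus> a) = \<one> \<oplus> (a \<ominus> b) \<otimes> inv (c' \<ominus> a)"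
      by (simp add: r[OF c(1)] r[OF c(2)])
    then have "(a \<ominus> b) \<otimes> inv (c \<ominus> a) = (a \<ominus> b) \<otimes> inv (c' \<ominus> a)"
      using cl by (simp add: a_comm[of \<one>])
    then have "inv (c \<ominus> a) = inv (c' \<ominus> a)"
      using ab' inv(2)[OF c(1)] inv(2)[OF c(2)] m_lcancel[of "a \<ominus> b"] by auto
    then have "inv (inv (c \<ominus> a)) = inv (inv (c' \<ominus> a))" by simp
    then have "c \<ominus> a = c' \<ominus> a"
      using inv(1)[OF c(1)] inv(1)[OF c(2)] field_Units by simp
    then show "c = c'" using c a by (simp add: a_minus_def)
  qed
  have "r ` (carrier F - {a, b}) \<subseteq> carrier F - {\<zero>, \<one>}"
  proof (rule image_subsetI)
    fix c assume c: "c \<in> carrier F - {a, b}"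
    have "c \<ominus> b \<in> units" using c b by (auto simp: diff_eq_zero_iff)
    then have 1: "r c \<in> units" unfolding r_def by (intro mult_closed_unit inv(2)[OF c])
    have u: "(a \<ominus> b) \<otimes> inv (c \<ominus> a) \<in> units"
      using ab' inv(2)[OF c] by (rule mult_closed_unit)
    have "r c \<noteq> \<one>"
    proof
      assume "r c = \<one>"
      then have "\<one> \<oplus> (a \<ominus> b) \<otimes> inv (c \<ominus> a) = \<one>"
        using r[OF c] by simp
      then have "(a \<ominus> b) \<otimes> inv (c \<ominus> a) = \<zero>"
        using u by (subst (asm) add.l_cancel_one) auto
      then show False using u by simp
    qed
    then show "r c \<in> carrier F - {\<zero>, \<one>}" using 1 by auto
  qed
  moreover have "card (r ` (carrier F - {a, b})) = card (carrier F - {\<zero>, \<one>})"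
    using a b ab finite_carrier by (simp add: card_image[OF inj] card_Diff_subset)
  ultimately have "r ` (carrier F - {a, b}) = carrier F - {\<zero>, \<one>}"
    using finite_carrier by (intro card_subset_eq) auto
  then show ?thesis using inj unfolding r_def bij_betw_def by blast
qed

text \<open>The value at \<open>u = \<one>\<close> is what the second moment of the fibre sums
  requires. A general unit \<open>u\<close> makes the family of counts closed under removing a
  coordinate, and real values allow subtraction.\<close>

definition agreement :: "nat set \<Rightarrow> (nat \<Rightarrow> int) \<Rightarrow> (nat \<Rightarrow> int) \<Rightarrow> int \<Rightarrow> real" where
  "agreement I a b u =
     (\<Sum>x\<in>space I. of_bool ((\<forall>k\<in>I. x k \<noteq> a k \<and> x k \<noteq> b k) \<and> diff_prod I x a = u \<otimes> diff_prod I x b))"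

text \<open>Once the coordinate \<open>c\<close> at \<open>i\<close> is fixed away from
  \<open>a i\<close> and \<open>b i\<close>, the factor \<open>c \<ominus> a i\<close> is
  invertible, and moving it to the other side multiplies \<open>u\<close> by the ratio of the two
  linear factors.\<close>

lemma agreement_insert:
  assumes I: "finite I" "i \<notin> I" and a: "a \<in> insert i I \<rightarrow> carrier F"
    and b: "b \<in> insert i I \<rightarrow> carrier F" and u: "u \<in> units"
  shows "agreement (insert i I) a b u
    = (\<Sum>c\<in>carrier F - {a i, b i}. agreement I a b (u \<otimes> ((c \<ominus> b i) \<otimes> inv (c \<ominus> a i))))"
proof -
  let ?ok = "\<lambda>x. \<forall>k\<in>I. x k \<noteq> a k \<and> x k \<noteq> b k"
  have "agreement (insert i I) a b u = (\<Sum>c\<in>carrier F. \<Sum>x\<in>space I.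
      of_bool ((\<forall>k\<in>insert i I. (x(i := c)) k \<noteq> a k \<and> (x(i := c)) k \<noteq> b k) \<and>
        diff_prod (insert i I) (x(i := c)) a = u \<otimes> diff_prod (insert i I) (x(i := c)) b))"
    unfolding agreement_def by (rule sum_PiE_insert[OF I(2)])
  also have "\<dots> = (\<Sum>c\<in>carrier F. \<Sum>x\<in>space I.
      of_bool (c \<notin> {a i, b i} \<and> ?ok x \<and>
        (c \<ominus> a i) \<otimes> diff_prod I x a = u \<otimes> ((c \<ominus> b i) \<otimes> diff_prod I x b)))"
    using I a b by (intro sum.cong refl arg_cong[of _ _ of_bool]) (auto simp: diff_prod_insert)
  also have "\<dots> = (\<Sum>c\<in>carrier F - {a i, b i}. \<Sum>x\<in>space I.
      of_bool (?ok x \<and> (c \<ominus> a i) \<otimes> diff_prod I x a = u \<otimes> ((c \<ominus> b i) \<otimes> diff_prod I x b)))"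
    using finite_carrier I(1) by (intro sum.mono_neutral_cong_right) auto
  also have "\<dots> = (\<Sum>c\<in>carrier F - {a i, b i}. agreement I a b (u \<otimes> ((c \<ominus> b i) \<otimes> inv (c \<ominus> a i))))"
    unfolding agreement_def
  proof (intro sum.cong refl arg_cong[of _ _ of_bool] conj_cong)
    fix c x assume c: "c \<in> carrier F - {a i, b i}" and x: "x \<in> space I"
    have P: "diff_prod I x a \<in> carrier F" "diff_prod I x b \<in> carrier F"
      using x a b by (auto intro!: diff_prod_closed)
    have ca: "c \<ominus> a i \<in> units" and cb: "c \<ominus> b i \<in> carrier F"
      using a b c by (auto simp: diff_eq_zero_iff)
    have i: "inv (c \<ominus> a i) \<in> carrier F" using inv_closed_unit[OF ca] by simp
    have "u \<otimes> ((c \<ominus> b i) \<otimes> diff_prod I x b) \<in> carrier F" using u cb P by simp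
    then have "(c \<ominus> a i) \<otimes> diff_prod I x a = u \<otimes> ((c \<ominus> b i) \<otimes> diff_prod I x b) \<longleftrightarrow>
        diff_prod I x a = inv (c \<ominus> a i) \<otimes> (u \<otimes> ((c \<ominus> b i) \<otimes> diff_prod I x b))"
      using ca P by (intro mult_eq_iff)
    also have "inv (c \<ominus> a i) \<otimes> (u \<otimes> ((c \<ominus> b i) \<otimes> diff_prod I x b))
        = u \<otimes> ((c \<ominus> b i) \<otimes> inv (c \<ominus> a i)) \<otimes> diff_prod I x b"
      using u cb P i by (simp add: m_ac)
    finally show "(c \<ominus> a i) \<otimes> diff_prod I x a = u \<otimes> ((c \<ominus> b i) \<otimes> diff_prod I x b) \<longleftrightarrow>
        diff_prod I x a = u \<otimes> ((c \<ominus> b i) \<otimes> inv (c \<ominus> a i)) \<otimes> diff_prod I x b" .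
  qed
  finally show ?thesis .
qed

text \<open>
  Summing the indicator of \<open>s = 1\<close> minus its mean over all units \<open>s\<close> gives \<open>0\<close>; this is what
  makes the correction term multiplicative in \<open>I\<close>.
\<close>

lemma agreement_formula:
  assumes "finite I" "a \<in> I \<rightarrow> carrier F" "b \<in> I \<rightarrow> carrier F" "u \<in> units"
  shows "(q - 1) * agreement I a b u
    = (\<Prod>k\<in>I. if a k = b k then q - 1 else q - 2)
      + ((if u = \<one> then q - 1 else 0) - 1) * tensor_kernel q I a b"
  using assms
proof (induction I arbitrary: u rule: finite_induct)
  case empty
  then show ?case
    \<comment> \<open>The space is a single point and all products are empty, so both sides equal
      \<open>q - 1\<close> if \<open>u = \<one>\<close> and 0 otherwise.\<close>
    by (auto simp: agreement_def tensor_kernel_def diff_prod_def PiE_empty_domain)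
next
  case (insert i I)
  define e where "e u = (if u = \<one> then q - 1 else 0) - 1" for u :: int
  define P where "P = (\<Prod>k\<in>I. if a k = b k then q - 1 else q - 2)"
  define K where "K = tensor_kernel q I a b"
  have ai: "a i \<in> carrier F" and bi: "b i \<in> carrier F" using insert.prems by auto
  have IH: "(q - 1) * agreement I a b v = P + e v * K" if "v \<in> units" for v
    using insert.IH[of v] insert.prems that by (auto simp: P_def K_def e_def)
  have K': "tensor_kernel q (insert i I) a b = ((if a i = b i then q else 0) - 1) * K"
    using insert.hyps by (simp add: tensor_kernel_def K_def)
  have ratio: "(c \<ominus> b i) \<otimes> inv (c \<ominus> a i) \<in> units" if "c \<in> carrier F - {a i, b i}" for c
    using that ai bi by (intro mult_closed_unit inv_closed_unit) (auto simp: diff_eq_zero_iff)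
  have "(q - 1) * agreement (insert i I) a b u
      = (\<Sum>c\<in>carrier F - {a i, b i}. P + e (u \<otimes> ((c \<ominus> b i) \<otimes> inv (c \<ominus> a i))) * K)"
  proof -
    have "(q - 1) * agreement I a b (u \<otimes> ((c \<ominus> b i) \<otimes> inv (c \<ominus> a i)))
        = P + e (u \<otimes> ((c \<ominus> b i) \<otimes> inv (c \<ominus> a i))) * K" if "c \<in> carrier F - {a i, b i}" for c
      by (intro IH mult_closed_unit ratio that insert.prems)
    then show ?thesis
      unfolding agreement_insert[OF insert.hyps insert.prems] sum_distrib_left
      by (intro sum.cong refl)
  qed
  also have "\<dots> = (if a i = b i then q - 1 else q - 2) * P + e u * (((if a i = b i then q else 0) - 1) * K)"
  \<comment> \<open>If \<open>a i = b i\<close>, all \<open>q - 1\<close> admissible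
    \<open>c\<close> have ratio 1 and leave \<open>u\<close> unchanged, so main term and correction
    both acquire the factor \<open>q - 1\<close>.\<close>
  proof (cases "a i = b i")
    case True
    have "u \<otimes> ((c \<ominus> b i) \<otimes> inv (c \<ominus> a i)) = u" if "c \<in> carrier F - {a i, b i}" for c
    proof -
      have "c \<ominus> a i \<in> Units F" using that ai by (auto simp: diff_eq_zero_iff field_Units)
      then show ?thesis using True insert.prems by simp
    qed
    then have "(\<Sum>c\<in>carrier F - {a i, b i}. P + e (u \<otimes> ((c \<ominus> b i) \<otimes> inv (c \<ominus> a i))) * K)
        = real (card (carrier F - {a i})) * (P + e u * K)"
      using True by simp
    also have "real (card (carrier F - {a i})) = q - 1"
      using ai finite_carrier q_ge_2 by (simp add: card_Diff_singleton of_nat_diff)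
    finally show ?thesis using True by (simp add: algebra_simps)
  next
    case False
    have "(\<Sum>c\<in>carrier F - {a i, b i}. P + e (u \<otimes> ((c \<ominus> b i) \<otimes> inv (c \<ominus> a i))) * K)
        = (\<Sum>s\<in>carrier F - {\<zero>, \<one>}. P + e (u \<otimes> s) * K)"
      by (rule sum.reindex_bij_betw[OF bij_betw_ratio[OF ai bi False]])
    \<comment> \<open>The ratios run once through the units other than 1. Since \<open>e\<close>
      sums to zero over all units, removing \<open>s = \<one>\<close> leaves \<open>- e u\<close>,
      and this sign is the off-diagonal entry of \<open>q I - J\<close>.\<close>
    also have "\<dots> = (\<Sum>s\<in>units. P + e (u \<otimes> s) * K) - (P + e u * K)"
    proof -
      have "units - {\<one>} = carrier F - {\<zero>, \<one>}" by auto
      then show ?thesis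
        using finite_carrier insert.prems sum.remove[of units \<one> "\<lambda>s. P + e (u \<otimes> s) * K"] by simp
    qed
    also have "(\<Sum>s\<in>units. P + e (u \<otimes> s) * K) = (q - 1) * P + (\<Sum>s\<in>units. e (u \<otimes> s)) * K"
      by (simp add: sum.distrib sum_distrib_right of_nat_card_minus_1)
    also have "(\<Sum>s\<in>units. e (u \<otimes> s)) = (\<Sum>s\<in>units. (if s = inv u then q - 1 else 0) - 1)"
    proof (rule sum.cong[OF refl])
      fix s assume s: "s \<in> units"
      have "u \<otimes> s = \<one> \<longleftrightarrow> s = inv u \<otimes> \<one>"
        using s insert.prems by (intro mult_eq_iff) auto
      then show "e (u \<otimes> s) = (if s = inv u then q - 1 else 0) - 1"
        using inv_closed_unit[of u] insert.prems by (simp add: e_def)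
    qed
    also have "\<dots> = 0"
      using inv_closed_unit[of u] insert.prems finite_carrier
      by (simp only: sum_subtractf sum.delta sum_constant finite_Diff card_units) simp
    finally show ?thesis using False by (simp add: algebra_simps)
  qed
  finally show ?case
    unfolding K' using insert.hyps by (simp add: P_def e_def)
qed

section \<open>Fibre sums and their second moments\<close>

text \<open>\<open>fibre_sum I j f x\<close> is the sum of \<open>f\<close> over the translate \<open>x - \<Pi>\<^sub>j\<close>.\<close>

definition fibre_sum :: "nat set \<Rightarrow> int \<Rightarrow> ((nat \<Rightarrow> int) \<Rightarrow> real) \<Rightarrow> (nat \<Rightarrow> int) \<Rightarrow> real" where
  "fibre_sum I j f x = (\<Sum>a\<in>space I. f a * of_bool (diff_prod I x a = j))"

text \<open>This is the total of the fibre sums over all units \<open>j\<close>, see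
  \<open>sum_fibre_sum\<close>. Divided by \<open>q - 1\<close> it is their mean; divided by
  \<open>(q - 1) ^ card I\<close> it is the convolution with the mean measure \<nu>.\<close>

definition unit_sum :: "nat set \<Rightarrow> ((nat \<Rightarrow> int) \<Rightarrow> real) \<Rightarrow> (nat \<Rightarrow> int) \<Rightarrow> real" where
  "unit_sum I f x = (\<Sum>a\<in>space I. f a * of_bool (\<forall>k\<in>I. x k \<noteq> a k))"

lemma sum_fibre_sum:
  assumes "finite I" "x \<in> space I"
  shows "(\<Sum>j\<in>units. fibre_sum I j f x) = unit_sum I f x"
proof -
  have "(\<Sum>j\<in>units. fibre_sum I j f x)
      = (\<Sum>a\<in>space I. f a * (\<Sum>j\<in>units. of_bool (diff_prod I x a = j)))"
    unfolding fibre_sum_def by (subst sum.swap) (simp add: sum_distrib_left)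
  also have "\<dots> = unit_sum I f x"
    unfolding unit_sum_def
  proof (intro sum.cong refl arg_cong[of _ _ "(*) _"])
    fix a assume a: "a \<in> space I"
    have "(\<Sum>j\<in>units. of_bool (diff_prod I x a = j)) = (of_bool (diff_prod I x a \<in> units) :: real)"
      using finite_carrier by (simp add: of_bool_def)
    also have "diff_prod I x a \<in> units \<longleftrightarrow> (\<forall>k\<in>I. x k \<noteq> a k)"
      using assms a diff_prod_closed[of x I a] diff_prod_eq_zero_iff[of I x a] by auto
    finally show "(\<Sum>j\<in>units. of_bool (diff_prod I x a = j)) = (of_bool (\<forall>k\<in>I. x k \<noteq> a k) :: real)" .
  qed
  finally show ?thesis .
qed

text \<open>Expanding the square leaves a sum over pairs \<open>a\<close>, \<open>b\<close>; summing
  over \<open>j\<close> forces both products to equal the same unit, which is the condition counted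
  by \<open>agreement\<close> at \<open>u = \<one>\<close>.\<close>

lemma sum_fibre_sum_squared:
  assumes "finite I"
  shows "(\<Sum>x\<in>space I. \<Sum>j\<in>units. (fibre_sum I j f x)\<^sup>2)
    = (\<Sum>a\<in>space I. \<Sum>b\<in>space I. f a * f b * agreement I a b \<one>)"
proof -
  have "(\<Sum>j\<in>units. (fibre_sum I j f x)\<^sup>2) = (\<Sum>a\<in>space I. \<Sum>b\<in>space I. f a * f b *
      of_bool ((\<forall>k\<in>I. x k \<noteq> a k \<and> x k \<noteq> b k) \<and> diff_prod I x a = \<one> \<otimes> diff_prod I x b))"
    if x: "x \<in> space I" for x
  proof -
    have "(\<Sum>j\<in>units. (fibre_sum I j f x)\<^sup>2) = (\<Sum>j\<in>units. \<Sum>a\<in>space I. \<Sum>b\<in>space I.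
        f a * f b * of_bool (diff_prod I x a = j \<and> diff_prod I x b = j))"
      by (simp add: fibre_sum_def power2_eq_square sum_product of_bool_conj mult_ac)
    also have "\<dots> = (\<Sum>a\<in>space I. \<Sum>b\<in>space I. \<Sum>j\<in>units.
        f a * f b * of_bool (diff_prod I x a = j \<and> diff_prod I x b = j))"
      by (subst sum.swap, rule sum.cong[OF refl], rule sum.swap)
    also have "\<dots> = (\<Sum>a\<in>space I. \<Sum>b\<in>space I. f a * f b *
      of_bool ((\<forall>k\<in>I. x k \<noteq> a k \<and> x k \<noteq> b k) \<and> diff_prod I x a = \<one> \<otimes> diff_prod I x b))"
      unfolding sum_distrib_left[symmetric]
    proof (intro sum.cong refl arg_cong[of _ _ "(*) _"])
      fix a b assume a: "a \<in> space I" and b: "b \<in> space I"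
      have P: "diff_prod I x a \<in> carrier F" "diff_prod I x b \<in> carrier F"
        using x a b by (auto intro!: diff_prod_closed)
      have "(\<Sum>j\<in>units. of_bool (diff_prod I x a = j \<and> diff_prod I x b = j))
          = (\<Sum>j\<in>units. if j = diff_prod I x a then of_bool (diff_prod I x b = diff_prod I x a) else 0 :: real)"
        by (intro sum.cong) auto
      also have "\<dots> = of_bool (diff_prod I x a \<in> units \<and> diff_prod I x b = diff_prod I x a)"
        using finite_carrier by simp
      also have "diff_prod I x a \<in> units \<and> diff_prod I x b = diff_prod I x a \<longleftrightarrow>
          (\<forall>k\<in>I. x k \<noteq> a k \<and> x k \<noteq> b k) \<and> diff_prod I x a = \<one> \<otimes> diff_prod I x b"
      proof -
        have "diff_prod I x a = \<zero> \<longleftrightarrow> (\<exists>k\<in>I. x k = a k)" "diff_prod I x b = \<zero> \<longleftrightarrow> (\<exists>k\<in>I. x k = b k)"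
          using assms x a b by (intro diff_prod_eq_zero_iff; auto)+
        then show ?thesis using P by auto
      qed
      finally show "(\<Sum>j\<in>units. of_bool (diff_prod I x a = j \<and> diff_prod I x b = j)) =
          (of_bool ((\<forall>k\<in>I. x k \<noteq> a k \<and> x k \<noteq> b k) \<and> diff_prod I x a = \<one> \<otimes> diff_prod I x b) :: real)" .
    qed
    finally show ?thesis .
  qed
  then have "(\<Sum>x\<in>space I. \<Sum>j\<in>units. (fibre_sum I j f x)\<^sup>2)
    = (\<Sum>x\<in>space I. \<Sum>a\<in>space I. \<Sum>b\<in>space I. f a * f b *
      of_bool ((\<forall>k\<in>I. x k \<noteq> a k \<and> x k \<noteq> b k) \<and> diff_prod I x a = \<one> \<otimes> diff_prod I x b))"
    by (rule sum.cong[OF refl])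
  also have "\<dots> = (\<Sum>a\<in>space I. \<Sum>b\<in>space I. \<Sum>x\<in>space I. f a * f b *
      of_bool ((\<forall>k\<in>I. x k \<noteq> a k \<and> x k \<noteq> b k) \<and> diff_prod I x a = \<one> \<otimes> diff_prod I x b))"
    by (subst sum.swap, rule sum.cong[OF refl], rule sum.swap)
  finally show ?thesis by (simp only: agreement_def sum_distrib_left)
qed

text \<open>The coordinates of \<open>x\<close> are constrained independently, each having
  \<open>q - 1\<close> or \<open>q - 2\<close> admissible values. The resulting product is the main
  term in \<open>agreement_formula\<close>, so it cancels in the variance.\<close>

lemma sum_unit_sum_squared:
  assumes I: "finite I"
  shows "(\<Sum>x\<in>space I. (unit_sum I f x)\<^sup>2)
    = (\<Sum>a\<in>space I. \<Sum>b\<in>space I. f a * f b * (\<Prod>k\<in>I. if a k = b k then q - 1 else q - 2))"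
proof -
  have count: "(\<Sum>x\<in>space I. of_bool (\<forall>k\<in>I. x k \<noteq> a k \<and> x k \<noteq> b k))
      = (\<Prod>k\<in>I. if a k = b k then q - 1 else q - 2)" if a: "a \<in> space I" and b: "b \<in> space I" for a b
  proof -
    have "(\<Sum>x\<in>space I. of_bool (\<forall>k\<in>I. x k \<noteq> a k \<and> x k \<noteq> b k))
        = real (card (\<Pi>\<^sub>E k\<in>I. carrier F - {a k, b k}))"
    proof -
      have "{x \<in> space I. \<forall>k\<in>I. x k \<noteq> a k \<and> x k \<noteq> b k} = (\<Pi>\<^sub>E k\<in>I. carrier F - {a k, b k})"
        by (auto simp: PiE_iff extensional_def)
      then show ?thesis using I by (simp add: Int_def sum_of_bool_eq)
    qed
    also have "\<dots> = (\<Prod>k\<in>I. real (card (carrier F - {a k, b k})))"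
      using I by (simp add: card_PiE)
    also have "\<dots> = (\<Prod>k\<in>I. if a k = b k then q - 1 else q - 2)"
    proof (rule prod.cong[OF refl])
      fix k assume "k \<in> I"
      then have "{a k, b k} \<subseteq> carrier F" using a b by auto
      then have "card (carrier F - {a k, b k}) + card {a k, b k} = card (carrier F)"
        using finite_carrier by (metis card_Diff_subset card_mono finite_subset le_add_diff_inverse2)
      then show "real (card (carrier F - {a k, b k})) = (if a k = b k then q - 1 else q - 2)"
        by (auto split: if_splits)
    qed
    finally show ?thesis .
  qed
  have "(\<Sum>x\<in>space I. (unit_sum I f x)\<^sup>2) = (\<Sum>x\<in>space I. \<Sum>a\<in>space I. \<Sum>b\<in>space I.
      f a * f b * of_bool (\<forall>k\<in>I. x k \<noteq> a k \<and> x k \<noteq> b k))"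
    by (simp add: unit_sum_def power2_eq_square sum_product ball_conj_distrib of_bool_conj mult_ac)
  also have "\<dots> = (\<Sum>a\<in>space I. \<Sum>b\<in>space I. \<Sum>x\<in>space I.
      f a * f b * of_bool (\<forall>k\<in>I. x k \<noteq> a k \<and> x k \<noteq> b k))"
    by (subst sum.swap, rule sum.cong[OF refl], rule sum.swap)
  also have "\<dots> = (\<Sum>a\<in>space I. \<Sum>b\<in>space I. f a * f b * (\<Prod>k\<in>I. if a k = b k then q - 1 else q - 2))"
    unfolding sum_distrib_left[symmetric] by (intro sum.cong refl) (simp only: count)
  finally show ?thesis .
qed

text \<open>For each \<open>x\<close> the sum over \<open>j\<close> is a variance: the sum of
  squares minus \<open>(unit_sum I f x)\<^sup>2 / (q - 1)\<close>. After multiplication by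
  \<open>q - 1\<close> the main terms cancel and only the projection kernel is left.\<close>

lemma fibre_sum_deviation_L2:
  assumes I: "finite I"
  shows "(\<Sum>x\<in>space I. \<Sum>j\<in>units. (fibre_sum I j f x - unit_sum I f x / (q - 1))\<^sup>2)
    \<le> q ^ card I * (\<Sum>a\<in>space I. (f a)\<^sup>2)"
proof -
  have q1: "q - 1 > 0" using q_ge_2 by simp
  define N where "N = (\<Sum>a\<in>space I. (f a)\<^sup>2)"
  have N: "N \<ge> 0" by (simp add: N_def sum_nonneg)
  have dev: "(\<Sum>j\<in>units. (fibre_sum I j f x - unit_sum I f x / (q - 1))\<^sup>2)
      = (\<Sum>j\<in>units. (fibre_sum I j f x)\<^sup>2) - (unit_sum I f x)\<^sup>2 / (q - 1)" if x: "x \<in> space I" for x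
  proof -
    define m where "m = unit_sum I f x / (q - 1)"
    have m: "unit_sum I f x = (q - 1) * m" using q1 by (simp add: m_def)
    have "(\<Sum>j\<in>units. (fibre_sum I j f x - m)\<^sup>2)
        = (\<Sum>j\<in>units. (fibre_sum I j f x)\<^sup>2 - 2 * m * fibre_sum I j f x + m\<^sup>2)"
      by (intro sum.cong refl) (simp add: power2_diff)
    also have "\<dots> = (\<Sum>j\<in>units. (fibre_sum I j f x)\<^sup>2) - 2 * m * unit_sum I f x + (q - 1) * m\<^sup>2"
      by (simp add: sum.distrib sum_subtractf sum_distrib_left[symmetric] sum_fibre_sum[OF I x] of_nat_card_minus_1)
    also have "\<dots> = (\<Sum>j\<in>units. (fibre_sum I j f x)\<^sup>2) - (unit_sum I f x)\<^sup>2 / (q - 1)"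
      using q1 unfolding m by (simp add: power2_eq_square)
    finally show ?thesis by (simp add: m_def)
  qed
  have "(q - 1) * (\<Sum>x\<in>space I. \<Sum>j\<in>units. (fibre_sum I j f x - unit_sum I f x / (q - 1))\<^sup>2)
      = (q - 1) * (\<Sum>x\<in>space I. \<Sum>j\<in>units. (fibre_sum I j f x)\<^sup>2) - (\<Sum>x\<in>space I. (unit_sum I f x)\<^sup>2)"
    using q1 by (simp add: dev sum_subtractf right_diff_distrib sum_divide_distrib[symmetric])
  also have "\<dots> = (\<Sum>a\<in>space I. \<Sum>b\<in>space I. f a * f b *
      ((q - 1) * agreement I a b \<one> - (\<Prod>k\<in>I. if a k = b k then q - 1 else q - 2)))"
    by (simp add: sum_fibre_sum_squared[OF I] sum_unit_sum_squared[OF I] sum_distrib_left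
        sum_subtractf right_diff_distrib mult_ac)
  also have "\<dots> = (\<Sum>a\<in>space I. \<Sum>b\<in>space I. f a * f b * ((q - 2) * tensor_kernel q I a b))"
    \<comment> \<open>At \<open>u = \<one>\<close> the coefficient of the kernel is
      \<open>(q - 1) - 1\<close>.\<close>
    using I by (intro sum.cong refl) (subst agreement_formula, auto simp: PiE_iff)
  also have "\<dots> = (q - 2) * (\<Sum>a\<in>space I. \<Sum>b\<in>space I. f a * f b * tensor_kernel q I a b)"
    by (simp add: sum_distrib_left mult_ac)
  also have "\<dots> \<le> (q - 2) * (q ^ card I * N)"
    unfolding N_def using q_ge_2 finite_carrier I
    by (intro mult_left_mono tensor_kernel_quadratic_form_le) auto
  also have "\<dots> \<le> (q - 1) * (q ^ card I * N)"
    using N by (intro mult_right_mono) auto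
  finally show ?thesis using q1 by (simp add: N_def)
qed

end

subsection \<open>The endpoint estimate\<close>

lemma powr_add_le:
  fixes a b p :: real
  assumes "a \<ge> 0" "b \<ge> 0" "p \<ge> 0"
  shows "(a + b) powr p \<le> 2 powr p * (a powr p + b powr p)"
proof -
  have "(a + b) powr p \<le> (2 * max a b) powr p"
    using assms by (intro powr_mono2) auto
  also have "\<dots> = 2 powr p * max a b powr p"
    using assms by (intro powr_mult)
  also have "max a b powr p \<le> a powr p + b powr p"
    by (simp add: max_def)
  finally show ?thesis by simp
qed

context finite_field
begin

section \<open>Reflections and the cardinality of the fibres\<close>

lemma diff_diff_cancel:
  assumes "x \<in> carrier F" "y \<in> carrier F"
  shows "x \<ominus> (x \<ominus> y) = y"
  using assms by (simp add: a_minus_def minus_add r_neg2)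

lemma sum_reflect:
  assumes x: "x \<in> space I"
  shows "(\<Sum>a\<in>space I. h a) = (\<Sum>y\<in>space I. h (\<lambda>k\<in>I. x k \<ominus> y k))"
proof (rule sum.reindex_bij_witness)
  fix a assume a: "a \<in> space I"
  have "(\<lambda>k\<in>I. x k \<ominus> (\<lambda>k\<in>I. x k \<ominus> a k) k) = a"
    using x a by (auto simp: PiE_iff extensional_def diff_diff_cancel)
  then show "(\<lambda>k\<in>I. x k \<ominus> (\<lambda>k\<in>I. x k \<ominus> a k) k) = a"
    and "(\<lambda>k\<in>I. x k \<ominus> (\<lambda>k\<in>I. x k \<ominus> a k) k) = a"
    and "h (\<lambda>k\<in>I. x k \<ominus> (\<lambda>k\<in>I. x k \<ominus> a k) k) = h a"
    by simp_all
  show "(\<lambda>k\<in>I. x k \<ominus> a k) \<in> space I" "(\<lambda>k\<in>I. x k \<ominus> a k) \<in> space I"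
    using x a by (auto simp: PiE_iff)
qed

lemma diff_prod_reflect:
  assumes "x \<in> space I" "y \<in> space I"
  shows "diff_prod I x (\<lambda>k\<in>I. x k \<ominus> y k) = (\<Otimes>k\<in>I. y k)"
  unfolding diff_prod_def using assms
  by (intro finprod_cong') (auto simp: PiE_iff diff_diff_cancel)

lemma count_diff_prod_insert:
  assumes I: "finite I" "i \<notin> I" and a: "a \<in> insert i I \<rightarrow> carrier F" and j: "j \<in> units"
  shows "(\<Sum>x\<in>space (insert i I). of_bool (diff_prod (insert i I) x a = j) :: real)
    = (\<Sum>c\<in>carrier F - {a i}. \<Sum>x\<in>space I. of_bool (diff_prod I x a = inv (c \<ominus> a i) \<otimes> j))"
proof -
  have "(\<Sum>x\<in>space (insert i I). of_bool (diff_prod (insert i I) x a = j) :: real)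
      = (\<Sum>c\<in>carrier F. \<Sum>x\<in>space I. of_bool ((c \<ominus> a i) \<otimes> diff_prod I x a = j))"
    unfolding sum_PiE_insert[OF I(2)] using I a
    by (intro sum.cong refl arg_cong[of _ _ of_bool]) (simp add: diff_prod_insert)
  also have "\<dots> = (\<Sum>c\<in>carrier F - {a i}. \<Sum>x\<in>space I. of_bool ((c \<ominus> a i) \<otimes> diff_prod I x a = j))"
  proof (intro sum.mono_neutral_right ballI sum.neutral)
    fix c x assume c: "c \<in> carrier F - (carrier F - {a i})" and x: "x \<in> space I"
    have "c \<ominus> a i = \<zero>" using c by (auto simp: diff_eq_zero_iff)
    moreover have "diff_prod I x a \<in> carrier F" using x a by (auto intro!: diff_prod_closed)
    ultimately show "of_bool ((c \<ominus> a i) \<otimes> diff_prod I x a = j) = (0::real)" using j by auto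
  qed (use finite_carrier in auto)
  also have "\<dots> = (\<Sum>c\<in>carrier F - {a i}. \<Sum>x\<in>space I. of_bool (diff_prod I x a = inv (c \<ominus> a i) \<otimes> j))"
  proof (intro sum.cong refl arg_cong[of _ _ of_bool] mult_eq_iff)
    fix c x assume "c \<in> carrier F - {a i}" "x \<in> space I"
    then show "c \<ominus> a i \<in> units" "diff_prod I x a \<in> carrier F" "j \<in> carrier F"
      using a j by (auto simp: diff_eq_zero_iff intro!: diff_prod_closed)
  qed
  finally show ?thesis .
qed

text \<open>A new coordinate has \<open>q - 1\<close> choices off \<open>a i\<close>, and each only
  replaces \<open>j\<close> by another unit, so the count for the remaining coordinates is the same.
  The induction starts at a singleton, where \<open>j \<oplus> a i\<close> is the only solution;
  over the empty set the count would depend on \<open>j\<close>.\<close>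

lemma count_diff_prod:
  assumes "finite I" "I \<noteq> {}" "a \<in> I \<rightarrow> carrier F" "j \<in> units"
  shows "(\<Sum>x\<in>space I. of_bool (diff_prod I x a = j)) = (q - 1) ^ (card I - 1)"
  using assms
proof (induction I arbitrary: j rule: finite_ne_induct)
  case (singleton i)
  have ai: "a i \<in> carrier F" using singleton by auto
  have "(\<Sum>x\<in>space {i}. of_bool (diff_prod {i} x a = j) :: real)
      = (\<Sum>c\<in>carrier F - {a i}. of_bool (\<one> = inv (c \<ominus> a i) \<otimes> j))"
    using count_diff_prod_insert[of "{}" i a j] singleton by (simp add: diff_prod_def)
  also have "\<dots> = (\<Sum>c\<in>carrier F - {a i}. if c = j \<oplus> a i then 1 else 0)"
  proof (rule sum.cong[OF refl])
    fix c assume c: "c \<in> carrier F - {a i}"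
    then have u: "c \<ominus> a i \<in> units" using ai by (auto simp: diff_eq_zero_iff)
    have "\<one> = inv (c \<ominus> a i) \<otimes> j \<longleftrightarrow> (c \<ominus> a i) \<otimes> \<one> = j"
      using u singleton.prems by (intro mult_eq_iff[symmetric]) auto
    also have "\<dots> \<longleftrightarrow> c \<ominus> a i = j" using u by simp
    also have "\<dots> \<longleftrightarrow> c = j \<oplus> a i"
    proof
      assume "c \<ominus> a i = j"
      then have "j \<oplus> a i = c \<ominus> a i \<oplus> a i" by simp
      then show "c = j \<oplus> a i" using c ai by (simp add: a_minus_def a_assoc l_neg)
    next
      assume "c = j \<oplus> a i"
      then show "c \<ominus> a i = j" using ai singleton.prems by (simp add: a_minus_def a_assoc r_neg)
    qed
    finally show "of_bool (\<one> = inv (c \<ominus> a i) \<otimes> j) = (if c = j \<oplus> a i then 1 else 0::real)" by simp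
  qed
  also have "\<dots> = 1"
  proof -
    have "j \<oplus> a i \<noteq> a i" using ai singleton.prems by (subst add.r_cancel_one) auto
    then show ?thesis using ai singleton.prems finite_carrier by simp
  qed
  finally show ?case by simp
next
  case (insert i I)
  have ai: "a i \<in> carrier F" using insert.prems by auto
  have "(\<Sum>x\<in>space (insert i I). of_bool (diff_prod (insert i I) x a = j) :: real)
      = (\<Sum>c\<in>carrier F - {a i}. (q - 1) ^ (card I - 1))"
    unfolding count_diff_prod_insert[OF insert.hyps(1,3) insert.prems]
  proof (rule sum.cong[OF refl])
    fix c assume "c \<in> carrier F - {a i}"
    then have "c \<ominus> a i \<in> units" using ai by (auto simp: diff_eq_zero_iff)
    then have "inv (c \<ominus> a i) \<otimes> j \<in> units"
      using insert.prems by (intro mult_closed_unit inv_closed_unit)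
    then show "(\<Sum>x\<in>space I. of_bool (diff_prod I x a = inv (c \<ominus> a i) \<otimes> j)) = (q - 1) ^ (card I - 1)"
      using insert.prems by (intro insert.IH) auto
  qed
  also have "\<dots> = (q - 1) * (q - 1) ^ (card I - 1)"
    using ai finite_carrier by (simp add: of_nat_card_minus_1)
  also have "\<dots> = (q - 1) ^ (card (insert i I) - 1)"
    using insert.hyps by (cases "card I") auto
  finally show ?case .
qed

lemma diff_prod_zero:
  assumes "y \<in> space I"
  shows "diff_prod I y (\<lambda>_. \<zero>) = (\<Otimes>k\<in>I. y k)"
  unfolding diff_prod_def using assms
  by (intro finprod_cong') (auto simp: PiE_iff a_minus_def)

text \<open>Reflecting in \<open>x\<close> turns the differences into the coordinates themselves,
  hence into the previous count with base point zero.\<close>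

lemma count_diff_prod_right:
  assumes "finite I" "I \<noteq> {}" and x: "x \<in> space I" and j: "j \<in> units"
  shows "(\<Sum>a\<in>space I. of_bool (diff_prod I x a = j)) = (q - 1) ^ (card I - 1)"
proof -
  have "(\<Sum>a\<in>space I. of_bool (diff_prod I x a = j)) = (\<Sum>y\<in>space I. of_bool (diff_prod I y (\<lambda>_. \<zero>) = j) :: real)"
    by (subst sum_reflect[OF x], intro sum.cong refl arg_cong[of _ _ of_bool])
      (simp add: diff_prod_reflect[OF x] diff_prod_zero)
  also have "\<dots> = (q - 1) ^ (card I - 1)"
    using assms by (intro count_diff_prod) auto
  finally show ?thesis .
qed

lemma count_avoiding:
  assumes "finite I" "b \<in> space I"
  shows "(\<Sum>a\<in>space I. of_bool (\<forall>k\<in>I. a k \<noteq> b k)) = (q - 1) ^ card I"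
proof -
  have "{a \<in> space I. \<forall>k\<in>I. a k \<noteq> b k} = (\<Pi>\<^sub>E k\<in>I. carrier F - {b k})"
    by (auto simp: PiE_iff extensional_def)
  then have "(\<Sum>a\<in>space I. of_bool (\<forall>k\<in>I. a k \<noteq> b k)) = real (card (\<Pi>\<^sub>E k\<in>I. carrier F - {b k}))"
    using assms by (simp add: Int_def sum_of_bool_eq)
  also have "\<dots> = (\<Prod>k\<in>I. real (card (carrier F - {b k})))"
    using assms by (simp add: card_PiE)
  also have "\<dots> = (\<Prod>k\<in>I. q - 1)"
    using assms finite_carrier
    by (intro prod.cong refl) (auto simp: PiE_iff card_Diff_singleton of_nat_card_minus_1)
  finally show ?thesis by simp
qed

section \<open>Total mass of fibre and unit sums, and Jensen's inequality for averages\<close>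

lemma sum_space_fibre_sum:
  assumes "finite I" "I \<noteq> {}" "j \<in> units"
  shows "(\<Sum>x\<in>space I. fibre_sum I j f x) = (q - 1) ^ (card I - 1) * (\<Sum>a\<in>space I. f a)"
proof -
  have "(\<Sum>x\<in>space I. fibre_sum I j f x)
      = (\<Sum>a\<in>space I. f a * (\<Sum>x\<in>space I. of_bool (diff_prod I x a = j)))"
    unfolding fibre_sum_def by (subst sum.swap) (simp only: sum_distrib_left)
  also have "\<dots> = (\<Sum>a\<in>space I. f a * (q - 1) ^ (card I - 1))"
    using assms by (intro sum.cong refl, subst count_diff_prod) (auto simp: PiE_iff)
  finally show ?thesis by (simp add: sum_distrib_right[symmetric] mult.commute)
qed

lemma sum_space_unit_sum:
  assumes "finite I"
  shows "(\<Sum>x\<in>space I. unit_sum I f x) = (q - 1) ^ card I * (\<Sum>a\<in>space I. f a)"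
proof -
  have "(\<Sum>x\<in>space I. unit_sum I f x)
      = (\<Sum>a\<in>space I. f a * (\<Sum>x\<in>space I. of_bool (\<forall>k\<in>I. x k \<noteq> a k)))"
    unfolding unit_sum_def by (subst sum.swap) (simp only: sum_distrib_left)
  also have "\<dots> = (\<Sum>a\<in>space I. f a * (q - 1) ^ card I)"
    using assms by (intro sum.cong refl) (simp only: count_avoiding)
  finally show ?thesis by (simp add: sum_distrib_right[symmetric] mult.commute)
qed

lemma powr_weighted_average_le:
  fixes f :: "'c \<Rightarrow> real"
  assumes X: "finite X" and n: "(\<Sum>a\<in>X. of_bool (P a)) = n" "n > 0" and p: "p \<ge> 1"
    and f: "\<And>a. a \<in> X \<Longrightarrow> f a \<ge> 0"
  shows "((\<Sum>a\<in>X. f a * of_bool (P a)) / n) powr p \<le> (\<Sum>a\<in>X. f a powr p * of_bool (P a)) / n"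
proof -
  define A where "A = {a \<in> X. P a}"
  have A: "finite A" using X by (simp add: A_def)
  have sum_A: "(\<Sum>a\<in>X. g a * of_bool (P a)) = (\<Sum>a\<in>A. g a)" for g :: "'c \<Rightarrow> real"
    using X unfolding A_def by (intro sum.mono_neutral_cong_right) auto
  have card_A: "real (card A) = n"
    using sum_A[of "\<lambda>_. 1"] n by simp
  then have "A \<noteq> {}" using n by auto
  then show ?thesis
    unfolding sum_A card_A[symmetric] using A p f by (intro powr_sum_average_le) (auto simp: A_def)
qed

lemma fibre_average_powr_le:
  assumes "finite I" "I \<noteq> {}" "x \<in> space I" "j \<in> units" "p \<ge> 1"
    and "\<And>a. a \<in> space I \<Longrightarrow> f a \<ge> 0"
  shows "(fibre_sum I j f x / (q - 1) ^ (card I - 1)) powr p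
    \<le> fibre_sum I j (\<lambda>a. f a powr p) x / (q - 1) ^ (card I - 1)"
  unfolding fibre_sum_def using assms q_ge_2
  by (intro powr_weighted_average_le count_diff_prod_right) simp_all

lemma unit_average_powr_le:
  assumes "finite I" "x \<in> space I" "p \<ge> 1" and "\<And>a. a \<in> space I \<Longrightarrow> f a \<ge> 0"
  shows "(unit_sum I f x / (q - 1) ^ card I) powr p
    \<le> unit_sum I (\<lambda>a. f a powr p) x / (q - 1) ^ card I"
proof -
  have "(\<Sum>a\<in>space I. of_bool (\<forall>k\<in>I. x k \<noteq> a k)) = (q - 1) ^ card I"
    using count_avoiding[OF assms(1,2)] by (simp only: eq_commute)
  then show ?thesis
    unfolding unit_sum_def using assms q_ge_2
    by (intro powr_weighted_average_le) simp_all
qed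

definition square_function :: "nat set \<Rightarrow> ((nat \<Rightarrow> int) \<Rightarrow> real) \<Rightarrow> (nat \<Rightarrow> int) \<Rightarrow> real" where
  "square_function I f x =
     L2_set (\<lambda>j. fibre_sum I j f x - unit_sum I f x / (q - 1)) units / (q - 1) ^ (card I - 1)"

lemma square_function_nonneg: "0 \<le> square_function I f x"
  using q_ge_2 by (simp add: square_function_def)

lemma square_function_add:
  "square_function I (\<lambda>a. f a + g a) x \<le> square_function I f x + square_function I g x"
proof -
  have "fibre_sum I j (\<lambda>a. f a + g a) x - unit_sum I (\<lambda>a. f a + g a) x / (q - 1)
      = (fibre_sum I j f x - unit_sum I f x / (q - 1)) + (fibre_sum I j g x - unit_sum I g x / (q - 1))" for j
    by (simp add: fibre_sum_def unit_sum_def distrib_right sum.distrib add_divide_distrib)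
  then have "L2_set (\<lambda>j. fibre_sum I j (\<lambda>a. f a + g a) x - unit_sum I (\<lambda>a. f a + g a) x / (q - 1)) units
      \<le> L2_set (\<lambda>j. fibre_sum I j f x - unit_sum I f x / (q - 1)) units
        + L2_set (\<lambda>j. fibre_sum I j g x - unit_sum I g x / (q - 1)) units"
    by (simp add: L2_set_triangle_ineq)
  then show ?thesis
    unfolding square_function_def add_divide_distrib[symmetric]
    using q_ge_2 by (intro divide_right_mono) auto
qed

lemma square_function_L2:
  assumes "finite I"
  shows "(\<Sum>x\<in>space I. (square_function I f x)\<^sup>2)
    \<le> q ^ card I / ((q - 1) ^ (card I - 1))\<^sup>2 * (\<Sum>a\<in>space I. (f a)\<^sup>2)"
proof -
  have "(\<Sum>x\<in>space I. (square_function I f x)\<^sup>2)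
      = (\<Sum>x\<in>space I. \<Sum>j\<in>units. (fibre_sum I j f x - unit_sum I f x / (q - 1))\<^sup>2)
        / ((q - 1) ^ (card I - 1))\<^sup>2"
    by (simp add: square_function_def L2_set_def power_divide sum_nonneg sum_divide_distrib)
  also have "\<dots> \<le> q ^ card I * (\<Sum>a\<in>space I. (f a)\<^sup>2) / ((q - 1) ^ (card I - 1))\<^sup>2"
    using assms by (intro divide_right_mono fibre_sum_deviation_L2) auto
  finally show ?thesis by simp
qed

lemma fibre_sum_nonneg: "(\<And>a. a \<in> space I \<Longrightarrow> 0 \<le> f a) \<Longrightarrow> 0 \<le> fibre_sum I j f x"
  unfolding fibre_sum_def by (intro sum_nonneg) auto

lemma unit_sum_nonneg: "(\<And>a. a \<in> space I \<Longrightarrow> 0 \<le> f a) \<Longrightarrow> 0 \<le> unit_sum I f x"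
  unfolding unit_sum_def by (intro sum_nonneg) auto

text \<open>The Euclidean norm is at most the sum of absolute values, and by positivity the fibre
  sums and their mean contribute equally to it, hence the 2. Each of the \<open>q - 1\<close> fibre
  averages preserves total mass.\<close>

lemma square_function_L1:
  assumes I: "finite I" "I \<noteq> {}" and f: "\<And>a. a \<in> space I \<Longrightarrow> 0 \<le> f a"
  shows "(\<Sum>x\<in>space I. square_function I f x) \<le> 2 * (q - 1) * (\<Sum>a\<in>space I. f a)"
proof -
  define n where "n = (q - 1) ^ (card I - 1)"
  have q1: "q - 1 > 0" using q_ge_2 by simp
  then have n: "n > 0" by (simp add: n_def)
  have "square_function I f x \<le> 2 * (\<Sum>j\<in>units. fibre_sum I j f x) / n" if x: "x \<in> space I" for x
  proof -
    have "L2_set (\<lambda>j. fibre_sum I j f x - unit_sum I f x / (q - 1)) units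
        \<le> (\<Sum>j\<in>units. \<bar>fibre_sum I j f x - unit_sum I f x / (q - 1)\<bar>)"
      by (rule L2_set_le_sum_abs)
    also have "\<dots> \<le> (\<Sum>j\<in>units. fibre_sum I j f x + unit_sum I f x / (q - 1))"
    proof (rule sum_mono)
      fix j
      have "fibre_sum I j f x \<ge> 0" "unit_sum I f x / (q - 1) \<ge> 0"
        using f q1 by (auto intro!: fibre_sum_nonneg unit_sum_nonneg divide_nonneg_pos)
      then show "\<bar>fibre_sum I j f x - unit_sum I f x / (q - 1)\<bar>
          \<le> fibre_sum I j f x + unit_sum I f x / (q - 1)" by linarith
    qed
    also have "\<dots> = 2 * (\<Sum>j\<in>units. fibre_sum I j f x)"
      using q1 by (simp add: sum.distrib of_nat_card_minus_1 sum_fibre_sum[OF I(1) x])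
    finally show ?thesis
      unfolding square_function_def n_def[symmetric] using n by (intro divide_right_mono) auto
  qed
  then have "(\<Sum>x\<in>space I. square_function I f x) \<le> (\<Sum>x\<in>space I. 2 * (\<Sum>j\<in>units. fibre_sum I j f x) / n)"
    by (rule sum_mono)
  also have "\<dots> = 2 * (\<Sum>j\<in>units. \<Sum>x\<in>space I. fibre_sum I j f x) / n"
    by (subst sum.swap) (simp add: sum_distrib_left sum_divide_distrib)
  also have "(\<Sum>j\<in>units. \<Sum>x\<in>space I. fibre_sum I j f x) = (\<Sum>j\<in>units. n * (\<Sum>a\<in>space I. f a))"
    unfolding n_def by (intro sum.cong refl sum_space_fibre_sum I)
  also have "2 * \<dots> / n = 2 * (q - 1) * (\<Sum>a\<in>space I. f a)"
    using n by (simp add: of_nat_card_minus_1)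
  finally show ?thesis .
qed

text \<open>One deviation is at most the Euclidean norm of all of them, so the upper bound does not
  depend on \<open>j\<close>.\<close>

lemma fibre_average_le:
  assumes I: "finite I" "I \<noteq> {}" and j: "j \<in> units"
  shows "fibre_sum I j f x / (q - 1) ^ (card I - 1)
    \<le> unit_sum I f x / (q - 1) ^ card I + square_function I f x"
proof -
  define n where "n = (q - 1) ^ (card I - 1)"
  have q1: "q - 1 > 0" using q_ge_2 by simp
  then have n: "n > 0" by (simp add: n_def)
  have nq: "(q - 1) ^ card I = n * (q - 1)"
    using I by (cases "card I") (auto simp: n_def)
  have "fibre_sum I j f x - unit_sum I f x / (q - 1)
      \<le> L2_set (\<lambda>j. fibre_sum I j f x - unit_sum I f x / (q - 1)) units"
    using j finite_carrier by (intro member_le_L2_set) auto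
  then have "(fibre_sum I j f x - unit_sum I f x / (q - 1)) / n \<le> square_function I f x"
    unfolding square_function_def n_def[symmetric] using n by (intro divide_right_mono) auto
  then show ?thesis
    unfolding n_def[symmetric] nq by (simp add: diff_divide_distrib mult.commute)
qed

end

section \<open>The critical exponent\<close>

definition endpoint :: "nat \<Rightarrow> real" where
  "endpoint d = real d / (real d - 1)"

text \<open>The power of 2 comes from splitting a sum under the power, the 1 from averaging over
  \<nu>, and the 4 from \<open>endpoint_balance\<close>. The maximum with 1 covers
  \<open>d = 2\<close>, where the L2 bound is used directly.\<close>

definition maximal_const :: "nat \<Rightarrow> real" where
  "maximal_const d = 2 powr endpoint d * (1 + 4 * max 1 (interpolation_const (endpoint d)))"

context finite_field
begin

text \<open>
  At \<open>p = d/(d-1)\<close> the growth \<open>q\<close> of the \<open>L\<^sup>1\<close> bound and the decay \<open>q\<^sup>(\<^sup>2\<^sup>-\<^sup>d\<^sup>)\<^sup>/\<^sup>2\<close> of the \<open>L\<^sup>2\<close> bound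
  balance exactly.
\<close>

lemma endpoint_balance:
  assumes d: "d \<ge> 2"
  shows "(2 * (q - 1)) powr (2 - endpoint d) * (q ^ d / ((q - 1) ^ (d - 1))\<^sup>2) powr (endpoint d - 1) \<le> 4"
proof -
  define p where "p = endpoint d"
  define t where "t = q - 1"
  have t: "t \<ge> 1" "q \<le> 2 * t" using q_ge_2 by (auto simp: t_def)
  have p: "p - 1 = 1 / (real d - 1)" using d by (simp add: p_def endpoint_def field_simps)
  have A: "q ^ d / (t ^ (d - 1))\<^sup>2 \<le> (2 * t) powr d / t powr (2 * (real d - 1))"
  proof -
    have "q ^ d \<le> (2 * t) ^ d" using t q_ge_2 by (intro power_mono) auto
    also have "\<dots> = (2 * t) powr d" using t by (simp add: powr_realpow)
    finally have 1: "q ^ d \<le> (2 * t) powr d" .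
    have "(t ^ (d - 1))\<^sup>2 = t ^ (2 * (d - 1))" by (simp add: power_mult[symmetric] mult.commute)
    also have "\<dots> = t powr real (2 * (d - 1))" using t by (subst powr_realpow) auto
    also have "real (2 * (d - 1)) = 2 * (real d - 1)" using d by (simp add: of_nat_diff)
    finally have "(t ^ (d - 1))\<^sup>2 = t powr (2 * (real d - 1))" .
    then show ?thesis using 1 by (simp add: divide_right_mono)
  qed
  \<comment> \<open>By these two identities the powers of \<open>2 * t\<close> combine to exponent 2
    and the denominator is \<open>t powr 2\<close>, so \<open>t\<close> disappears and
    \<open>2 powr 2\<close> is left.\<close>
  have e1: "d * (p - 1) = p" using d unfolding p by (simp add: p_def endpoint_def)
  have e2: "2 * (real d - 1) * (p - 1) = 2" using d unfolding p by (simp add: field_simps)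
  have "(q ^ d / (t ^ (d - 1))\<^sup>2) powr (p - 1) \<le> ((2 * t) powr d / t powr (2 * (real d - 1))) powr (p - 1)"
    using A t d p by (intro powr_mono2) auto
  also have "\<dots> = (2 * t) powr (d * (p - 1)) / t powr (2 * (real d - 1) * (p - 1))"
    using t by (simp add: powr_divide powr_powr)
  also have "\<dots> = (2 * t) powr p / t powr 2" unfolding e1 e2 ..
  finally have "(2 * t) powr (2 - p) * (q ^ d / (t ^ (d - 1))\<^sup>2) powr (p - 1)
      \<le> (2 * t) powr (2 - p) * ((2 * t) powr p / t powr 2)"
    by (intro mult_left_mono) auto
  also have "\<dots> = (2 * t) powr 2 / t powr 2" using t by (simp add: powr_add[symmetric])
  also have "\<dots> = 4" using t by (simp add: powr_mult)
  finally show ?thesis by (simp add: p_def t_def)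
qed

text \<open>For \<open>d > 2\<close> the endpoint lies strictly between 1 and 2 and the
  interpolation applies. For \<open>d = 2\<close> it equals 2, and the constant \<open>c\<close> is
  the L2 constant itself.\<close>

lemma square_function_endpoint:
  assumes I: "finite I" "card I \<ge> 2" and f: "\<And>a. a \<in> space I \<Longrightarrow> f a \<ge> 0"
  shows "(\<Sum>x\<in>space I. square_function I f x powr endpoint (card I))
    \<le> 4 * max 1 (interpolation_const (endpoint (card I))) * (\<Sum>a\<in>space I. f a powr endpoint (card I))"
proof -
  define d where "d = card I"
  define p where "p = endpoint d"
  define A2 where "A2 = q ^ d / ((q - 1) ^ (d - 1))\<^sup>2"
  define c where "c = (2 * (q - 1)) powr (2 - p) * A2 powr (p - 1)"
  have d: "d \<ge> 2" "I \<noteq> {}" using I by (auto simp: d_def)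
  have q1: "q - 1 > 0" using q_ge_2 by simp
  then have A2: "A2 > 0" using q_ge_2 by (simp add: A2_def)
  have c: "c \<le> 4" using endpoint_balance[OF d(1)] by (simp add: c_def A2_def p_def)
  have S: "(\<Sum>a\<in>space I. f a powr p) \<ge> 0" by (intro sum_nonneg) auto
  have "(\<Sum>x\<in>space I. square_function I f x powr p)
      \<le> max 1 (interpolation_const p) * c * (\<Sum>a\<in>space I. f a powr p)"
  proof (cases "d = 2")
    case True
    then have p2: "p = 2" by (simp add: p_def endpoint_def)
    have "(\<Sum>x\<in>space I. square_function I f x powr p) \<le> A2 * (\<Sum>a\<in>space I. f a powr p)"
      using square_function_L2[OF I(1), of f] f
      by (simp add: p2 square_function_nonneg A2_def d_def)
    also have "\<dots> = c * (\<Sum>a\<in>space I. f a powr p)"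
      using A2 q1 by (simp add: c_def p2)
    also have "\<dots> = 1 * (c * (\<Sum>a\<in>space I. f a powr p))" by simp
    also have "\<dots> \<le> max 1 (interpolation_const p) * (c * (\<Sum>a\<in>space I. f a powr p))"
      using S by (intro mult_right_mono) (auto simp: c_def)
    finally show ?thesis by (simp add: mult.assoc)
  next
    case False
    then have p: "1 < p" "p < 2" using d by (auto simp: p_def endpoint_def field_simps)
    have "(\<Sum>x\<in>space I. square_function I f x powr p)
      \<le> interpolation_const p * (2 * (q - 1)) powr (2 - p) * A2 powr (p - 1) * (\<Sum>a\<in>space I. f a powr p)"
    proof (rule sublinear_interpolation)
      fix g assume g: "\<And>x. x \<in> space I \<Longrightarrow> 0 \<le> (g x :: real)"
      show "(\<Sum>x\<in>space I. square_function I g x) \<le> 2 * (q - 1) * (\<Sum>x\<in>space I. g x)"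
        using I(1) d(2) g by (rule square_function_L1)
      show "(\<Sum>x\<in>space I. (square_function I g x)\<^sup>2) \<le> A2 * (\<Sum>x\<in>space I. (g x)\<^sup>2)"
        unfolding A2_def d_def using I(1) by (rule square_function_L2)
    qed (use I(1) p q1 A2 f in \<open>simp_all add: square_function_nonneg square_function_add\<close>)
    also have "\<dots> = interpolation_const p * (c * (\<Sum>a\<in>space I. f a powr p))"
      by (simp add: c_def)
    also have "\<dots> \<le> max 1 (interpolation_const p) * (c * (\<Sum>a\<in>space I. f a powr p))"
      using S by (intro mult_right_mono) (auto simp: c_def)
    finally show ?thesis by (simp add: mult.assoc)
  qed
  also have "\<dots> \<le> max 1 (interpolation_const p) * 4 * (\<Sum>a\<in>space I. f a powr p)"
    using c S by (intro mult_right_mono mult_left_mono) auto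
  finally show ?thesis by (simp add: p_def d_def mult_ac)
qed

text \<open>The function \<open>j\<close> linearizes the supremum over \<open>j\<close>.\<close>

lemma maximal_endpoint:
  assumes I: "finite I" "card I \<ge> 2" and f: "\<And>a. a \<in> space I \<Longrightarrow> f a \<ge> 0"
    and j: "\<And>x. x \<in> space I \<Longrightarrow> j x \<in> units"
  shows "(\<Sum>x\<in>space I. (fibre_sum I (j x) f x / (q - 1) ^ (card I - 1)) powr endpoint (card I))
    \<le> maximal_const (card I) * (\<Sum>a\<in>space I. f a powr endpoint (card I))"
proof -
  define p where "p = endpoint (card I)"
  have p: "p \<ge> 1" using I by (simp add: p_def endpoint_def field_simps)
  have ne: "I \<noteq> {}" using I by auto
  have q1: "q - 1 > 0" using q_ge_2 by simp
  have "(\<Sum>x\<in>space I. (fibre_sum I (j x) f x / (q - 1) ^ (card I - 1)) powr p)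
      \<le> (\<Sum>x\<in>space I. 2 powr p * ((unit_sum I f x / (q - 1) ^ card I) powr p + square_function I f x powr p))"
  proof (rule sum_mono)
    fix x assume x: "x \<in> space I"
    have "(fibre_sum I (j x) f x / (q - 1) ^ (card I - 1)) powr p
        \<le> (unit_sum I f x / (q - 1) ^ card I + square_function I f x) powr p"
      using I ne j[OF x] f q1 p
      by (intro powr_mono2 fibre_average_le divide_nonneg_pos fibre_sum_nonneg) auto
    also have "\<dots> \<le> 2 powr p * ((unit_sum I f x / (q - 1) ^ card I) powr p + square_function I f x powr p)"
      using f q1 p by (intro powr_add_le divide_nonneg_pos unit_sum_nonneg square_function_nonneg) auto
    finally show "(fibre_sum I (j x) f x / (q - 1) ^ (card I - 1)) powr p
      \<le> 2 powr p * ((unit_sum I f x / (q - 1) ^ card I) powr p + square_function I f x powr p)" .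
  qed
  also have "\<dots> = 2 powr p * ((\<Sum>x\<in>space I. (unit_sum I f x / (q - 1) ^ card I) powr p)
      + (\<Sum>x\<in>space I. square_function I f x powr p))"
    by (simp add: sum_distrib_left[symmetric] sum.distrib)
  also have "\<dots> \<le> 2 powr p * ((\<Sum>a\<in>space I. f a powr p)
      + 4 * max 1 (interpolation_const p) * (\<Sum>a\<in>space I. f a powr p))"
  proof (intro mult_left_mono add_mono)
    \<comment> \<open>Averaging against a probability measure: Jensen pointwise, then preservation
      of total mass, with constant 1.\<close>
    have "(\<Sum>x\<in>space I. (unit_sum I f x / (q - 1) ^ card I) powr p)
        \<le> (\<Sum>x\<in>space I. unit_sum I (\<lambda>a. f a powr p) x / (q - 1) ^ card I)"
      using I p f by (intro sum_mono unit_average_powr_le) auto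
    also have "\<dots> = (\<Sum>a\<in>space I. f a powr p)"
      using q1 I by (simp add: sum_divide_distrib[symmetric] sum_space_unit_sum)
    finally show "(\<Sum>x\<in>space I. (unit_sum I f x / (q - 1) ^ card I) powr p) \<le> (\<Sum>a\<in>space I. f a powr p)" .
    show "(\<Sum>x\<in>space I. square_function I f x powr p)
        \<le> 4 * max 1 (interpolation_const p) * (\<Sum>a\<in>space I. f a powr p)"
      unfolding p_def using I f by (rule square_function_endpoint)
  qed auto
  also have "\<dots> = maximal_const (card I) * (\<Sum>a\<in>space I. f a powr p)"
    by (simp add: maximal_const_def p_def algebra_simps)
  finally show ?thesis by (simp add: p_def)
qed

text \<open>With \<open>s = p / r\<close> and \<open>r\<close> the endpoint, Jensen bounds the
  \<open>s\<close>-th power of an average of \<open>f\<close> by the average of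
  \<open>f powr s\<close>, to which the endpoint estimate applies. The constant therefore does not
  deteriorate.\<close>

lemma maximal_Lp:
  assumes I: "finite I" "card I \<ge> 2" and f: "\<And>a. a \<in> space I \<Longrightarrow> f a \<ge> 0"
    and j: "\<And>x. x \<in> space I \<Longrightarrow> j x \<in> units" and p: "p \<ge> endpoint (card I)"
  shows "(\<Sum>x\<in>space I. (fibre_sum I (j x) f x / (q - 1) ^ (card I - 1)) powr p)
    \<le> maximal_const (card I) * (\<Sum>a\<in>space I. f a powr p)"
proof -
  define r where "r = endpoint (card I)"
  have r: "r \<ge> 1" using I by (simp add: r_def endpoint_def field_simps)
  define s where "s = p / r"
  have s: "s \<ge> 1" and sr: "s * r = p" using p r by (auto simp: s_def r_def)
  have ne: "I \<noteq> {}" using I by auto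
  have "(\<Sum>x\<in>space I. (fibre_sum I (j x) f x / (q - 1) ^ (card I - 1)) powr p)
      \<le> (\<Sum>x\<in>space I. (fibre_sum I (j x) (\<lambda>a. f a powr s) x / (q - 1) ^ (card I - 1)) powr r)"
  proof (rule sum_mono)
    fix x assume x: "x \<in> space I"
    have "(fibre_sum I (j x) f x / (q - 1) ^ (card I - 1)) powr p
        = ((fibre_sum I (j x) f x / (q - 1) ^ (card I - 1)) powr s) powr r"
      by (simp add: powr_powr sr)
    also have "\<dots> \<le> (fibre_sum I (j x) (\<lambda>a. f a powr s) x / (q - 1) ^ (card I - 1)) powr r"
      using I ne x j[OF x] f s r by (intro powr_mono2 fibre_average_powr_le) auto
    finally show "(fibre_sum I (j x) f x / (q - 1) ^ (card I - 1)) powr p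
        \<le> (fibre_sum I (j x) (\<lambda>a. f a powr s) x / (q - 1) ^ (card I - 1)) powr r" .
  qed
  also have "\<dots> \<le> maximal_const (card I) * (\<Sum>a\<in>space I. (f a powr s) powr r)"
    unfolding r_def using I j by (intro maximal_endpoint) auto
  finally show ?thesis by (simp add: powr_powr sr)
qed

end

subsection \<open>The maximal function\<close>

context finite_field
begin

lemma vecs_eq: "vecs F d = space {1..d}"
  by (simp add: vecs_def)

lemma sum_product_variety:
  assumes x: "x \<in> space {1..d}"
  shows "(\<Sum>y\<in>product_variety F d j. f (vec_diff F d x y)) = fibre_sum {1..d} j f x"
proof -
  have "fibre_sum {1..d} j f x
      = (\<Sum>y\<in>space {1..d}. f (\<lambda>k\<in>{1..d}. x k \<ominus> y k) * of_bool ((\<Otimes>k\<in>{1..d}. y k) = j))"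
    unfolding fibre_sum_def
    by (subst sum_reflect[OF x], intro sum.cong refl) (simp only: diff_prod_reflect[OF x])
  also have "\<dots> = (\<Sum>y\<in>product_variety F d j. f (vec_diff F d x y))"
    unfolding product_variety_def vec_diff_def vecs_eq
    by (intro sum.mono_neutral_cong_right) auto
  finally show ?thesis by simp
qed

lemma card_product_variety:
  assumes "d \<ge> 1" "j \<in> units"
  shows "real (card (product_variety F d j)) = (q - 1) ^ (d - 1)"
proof -
  have "real (card (product_variety F d j)) = (\<Sum>y\<in>space {1..d}. of_bool ((\<Otimes>k\<in>{1..d}. y k) = j))"
    unfolding product_variety_def vecs_eq by (simp add: Int_def sum_of_bool_eq)
  also have "\<dots> = (\<Sum>y\<in>space {1..d}. of_bool (diff_prod {1..d} y (\<lambda>_. \<zero>) = j))"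
    by (intro sum.cong refl arg_cong[of _ _ of_bool]) (simp add: diff_prod_zero)
  also have "\<dots> = (q - 1) ^ (d - 1)"
    using assms count_diff_prod[of "{1..d}" "\<lambda>_. \<zero>" j] by simp
  finally show ?thesis .
qed

lemma norm_surface_average_le:
  assumes "d \<ge> 1" "x \<in> space {1..d}" "j \<in> units"
  shows "norm (surface_average F d j f x) \<le> fibre_sum {1..d} j (\<lambda>a. norm (f a)) x / (q - 1) ^ (d - 1)"
proof -
  have "norm (surface_average F d j f x)
      = norm (\<Sum>y\<in>product_variety F d j. f (vec_diff F d x y)) / (q - 1) ^ (d - 1)"
    using card_product_variety[OF assms(1,3)] by (simp add: surface_average_def norm_divide)
  also have "\<dots> \<le> (\<Sum>y\<in>product_variety F d j. norm (f (vec_diff F d x y))) / (q - 1) ^ (d - 1)"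
    using q_ge_2 by (intro divide_right_mono norm_sum) auto
  also have "\<dots> = fibre_sum {1..d} j (\<lambda>a. norm (f a)) x / (q - 1) ^ (d - 1)"
    using sum_product_variety[OF assms(2), where f = "\<lambda>a. norm (f a)"] by simp
  finally show ?thesis .
qed

lemma maximal_function_attained:
  "\<exists>j\<in>units. maximal_function F d f x = norm (surface_average F d j f x)"
proof -
  have "finite ((\<lambda>j. norm (surface_average F d j f x)) ` units)" "(\<lambda>j. norm (surface_average F d j f x)) ` units \<noteq> {}"
    using finite_carrier one_closed one_not_zero by blast+
  then have "maximal_function F d f x \<in> (\<lambda>j. norm (surface_average F d j f x)) ` units"
    unfolding maximal_function_def by (metis Max_in cSup_eq_Max)
  then show ?thesis by auto
qed

lemma maximal_function_ge:
  "j \<in> units \<Longrightarrow> norm (surface_average F d j f x) \<le> maximal_function F d f x"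
  unfolding maximal_function_def using finite_carrier by (intro cSUP_upper) auto

text \<open>The supremum runs over a finite nonempty set, so a maximizing index can be chosen at
  each point; the triangle inequality then reduces complex \<open>f\<close> to its absolute
  value.\<close>

lemma maximal_function_linearize:
  assumes "d \<ge> 1"
  obtains j where "\<And>x. x \<in> space {1..d} \<Longrightarrow> j x \<in> units"
    and "\<And>x. x \<in> space {1..d} \<Longrightarrow> norm (maximal_function F d f x)
      \<le> fibre_sum {1..d} (j x) (\<lambda>a. norm (f a)) x / (q - 1) ^ (d - 1)"
proof -
  obtain j where j: "\<And>x. j x \<in> units" "\<And>x. maximal_function F d f x = norm (surface_average F d (j x) f x)"
    using maximal_function_attained[of d f] by metis
  show thesis
    using j norm_surface_average_le[OF assms] by (intro that[of j]) simp_all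
qed

lemma Lp_norm_maximal_function_le:
  assumes d: "d \<ge> 2" and p: "p \<ge> endpoint d"
  shows "Lp_norm F d (ereal p) (maximal_function F d f) \<le> maximal_const d powr (1/p) * Lp_norm F d (ereal p) f"
proof -
  have "endpoint d \<ge> 1" using d by (simp add: endpoint_def field_simps)
  then have p1: "p \<ge> 1" using p by linarith
  obtain j where j: "\<And>x. x \<in> space {1..d} \<Longrightarrow> j x \<in> units"
    and le: "\<And>x. x \<in> space {1..d} \<Longrightarrow> norm (maximal_function F d f x)
      \<le> fibre_sum {1..d} (j x) (\<lambda>a. norm (f a)) x / (q - 1) ^ (d - 1)"
    using maximal_function_linearize[of d f] d by auto
  have "(\<Sum>x\<in>vecs F d. norm (maximal_function F d f x) powr p)
      \<le> (\<Sum>x\<in>space {1..d}. (fibre_sum {1..d} (j x) (\<lambda>a. norm (f a)) x / (q - 1) ^ (d - 1)) powr p)"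
    unfolding vecs_eq using p1 by (intro sum_mono powr_mono2 le) auto
  also have "\<dots> \<le> maximal_const d * (\<Sum>x\<in>vecs F d. norm (f x) powr p)"
    using maximal_Lp[of "{1..d}" "\<lambda>a. norm (f a)" j p] d p j by (simp add: vecs_eq)
  finally have "(\<Sum>x\<in>vecs F d. norm (maximal_function F d f x) powr p) / q ^ d
      \<le> maximal_const d * (\<Sum>x\<in>vecs F d. norm (f x) powr p) / q ^ d"
    by (intro divide_right_mono) auto
  then have "((\<Sum>x\<in>vecs F d. norm (maximal_function F d f x) powr p) / q ^ d) powr (1/p)
      \<le> (maximal_const d * ((\<Sum>x\<in>vecs F d. norm (f x) powr p) / q ^ d)) powr (1/p)"
    using p1 by (intro powr_mono2) (auto intro!: divide_nonneg_nonneg sum_nonneg)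
  also have "\<dots> = maximal_const d powr (1/p) * ((\<Sum>x\<in>vecs F d. norm (f x) powr p) / q ^ d) powr (1/p)"
    by (rule powr_mult)
  finally show ?thesis by (simp add: Lp_norm_def)
qed

lemma Max_norm_maximal_function_le:
  assumes d: "d \<ge> 1"
  shows "Lp_norm F d \<infinity> (maximal_function F d f) \<le> Lp_norm F d \<infinity> f"
proof -
  define M where "M = Max ((\<lambda>x. norm (f x)) ` vecs F d)"
  have V: "finite (vecs F d)" by (simp add: vecs_eq)
  have "(\<lambda>_\<in>{1..d}. \<zero>) \<in> vecs F d" by (auto simp: vecs_eq)
  then have ne: "vecs F d \<noteq> {}" by auto
  have M: "norm (f x) \<le> M" if "x \<in> space {1..d}" for x
    using V that by (auto simp: M_def vecs_eq)
  obtain j where j: "\<And>x. x \<in> space {1..d} \<Longrightarrow> j x \<in> units"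
    and le: "\<And>x. x \<in> space {1..d} \<Longrightarrow> norm (maximal_function F d f x)
      \<le> fibre_sum {1..d} (j x) (\<lambda>a. norm (f a)) x / (q - 1) ^ (d - 1)"
    using maximal_function_linearize[of d f] d by auto
  have "norm (maximal_function F d f x) \<le> M" if x: "x \<in> space {1..d}" for x
  proof -
    have n: "(q - 1) ^ (d - 1) > 0" using q_ge_2 by simp
    have "fibre_sum {1..d} (j x) (\<lambda>a. norm (f a)) x
        \<le> (\<Sum>a\<in>space {1..d}. M * of_bool (diff_prod {1..d} x a = j x))"
      unfolding fibre_sum_def using M by (intro sum_mono mult_right_mono) auto
    also have "\<dots> = M * (q - 1) ^ (d - 1)"
      using d x j[OF x] by (simp only: sum_distrib_left[symmetric]) (subst count_diff_prod_right, auto)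
    finally have "fibre_sum {1..d} (j x) (\<lambda>a. norm (f a)) x / (q - 1) ^ (d - 1) \<le> M"
      using n by (simp add: pos_divide_le_eq)
    then show ?thesis using le[OF x] by linarith
  qed
  then show ?thesis
    using V ne by (simp add: Lp_norm_def M_def[symmetric]) (auto simp: vecs_eq)
qed

text \<open>Let \<open>f\<close> be the indicator of the origin. At a point \<open>x\<close> of
  \<open>U\<close> the variety through \<open>x\<close> has index \<open>j\<close> equal to the
  product of the coordinates of \<open>x\<close>, and exactly one of its \<open>n\<close> points
  contributes. The normalizations \<open>q ^ d\<close> cancel between the two norms.\<close>

lemma Lp_constant_ge_point_mass:
  assumes d: "d \<ge> 1" and p: "p \<ge> 1" and C: "\<And>f :: (nat \<Rightarrow> int) \<Rightarrow> complex.
      Lp_norm F d (ereal p) (maximal_function F d f) \<le> C * Lp_norm F d (ereal p) f"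
  shows "(q - 1) powr (d / p - (real d - 1)) \<le> C"
proof -
  define o' where "o' = (\<lambda>_\<in>{1..d}. \<zero>)"
  define f :: "(nat \<Rightarrow> int) \<Rightarrow> complex" where "f a = of_bool (a = o')" for a
  define n where "n = (q - 1) ^ (d - 1)"
  have q1: "q - 1 > 0" using q_ge_2 by simp
  then have n: "n > 0" by (simp add: n_def)
  have o': "o' \<in> vecs F d" by (auto simp: o'_def vecs_eq)
  have V: "finite (vecs F d)" by (simp add: vecs_eq)
  define U where "U = {1..d} \<rightarrow>\<^sub>E units"
  have U: "U \<subseteq> vecs F d" by (auto simp: U_def vecs_eq PiE_iff)
  have cardU: "real (card U) = (q - 1) ^ d"
    using finite_carrier by (simp add: U_def card_PiE of_nat_card_minus_1)
  have lower: "1 / n \<le> maximal_function F d f x" if x: "x \<in> U" for x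
  proof -
    define j where "j = (\<Otimes>k\<in>{1..d}. x k)"
    have xV: "x \<in> space {1..d}" using x U by (auto simp: vecs_eq)
    have "j \<in> carrier F" unfolding j_def using xV by (intro finprod_closed) (auto simp: PiE_iff)
    moreover have "j \<noteq> \<zero>"
      unfolding j_def using xV x by (subst finprod_eq_zero_iff) (auto simp: U_def PiE_iff)
    ultimately have j: "j \<in> units" by simp
    have xP: "x \<in> product_variety F d j" using xV by (simp add: product_variety_def j_def vecs_eq)
    have P: "finite (product_variety F d j)" using V by (simp add: product_variety_def)
    have diff: "vec_diff F d x y = o' \<longleftrightarrow> y = x" if "y \<in> product_variety F d j" for y
    proof
      assume eq: "vec_diff F d x y = o'"
      have y: "y \<in> space {1..d}" using that by (simp add: product_variety_def vecs_eq)
      have "x k = y k" if "k \<in> {1..d}" for k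
        using fun_cong[OF eq, of k] that xV y diff_eq_zero_iff[of "x k" "y k"]
        by (auto simp: vec_diff_def o'_def PiE_iff)
      then show "y = x" using xV y by (intro PiE_ext) auto
    next
      assume "y = x"
      then show "vec_diff F d x y = o'"
        using xV by (auto simp: vec_diff_def o'_def PiE_iff diff_eq_zero_iff)
    qed
    have "(\<Sum>y\<in>product_variety F d j. f (vec_diff F d x y)) = (\<Sum>y\<in>product_variety F d j. if y = x then 1 else 0)"
      by (intro sum.cong refl) (simp add: f_def diff)
    also have "\<dots> = 1" using P xP by simp
    finally have "norm (surface_average F d j f x) = 1 / n"
      using card_product_variety[OF d j] by (simp add: surface_average_def norm_divide n_def)
    then show ?thesis using maximal_function_ge[OF j, of d f x] by simp
  qed
  have "(q - 1) ^ d * (1 / n) powr p = (\<Sum>x\<in>U. (1 / n) powr p)" by (simp add: cardU)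
  also have "\<dots> \<le> (\<Sum>x\<in>U. norm (maximal_function F d f x) powr p)"
    using n p by (intro sum_mono powr_mono2) (auto intro: order_trans[OF lower])
  also have "\<dots> \<le> (\<Sum>x\<in>vecs F d. norm (maximal_function F d f x) powr p)"
    using V U by (intro sum_mono2) auto
  finally have "((q - 1) ^ d * (1 / n) powr p / q ^ d) powr (1/p)
      \<le> ((\<Sum>x\<in>vecs F d. norm (maximal_function F d f x) powr p) / q ^ d) powr (1/p)"
    using q1 p by (intro powr_mono2 divide_right_mono) auto
  also have "\<dots> \<le> C * Lp_norm F d (ereal p) f"
    using C[of f] by (simp add: Lp_norm_def)
  also have "Lp_norm F d (ereal p) f = (1 / q ^ d) powr (1/p)"
  proof -
    have "(\<Sum>x\<in>vecs F d. norm (f x) powr p) = (\<Sum>x\<in>vecs F d. if x = o' then 1 else 0)"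
      using p by (intro sum.cong refl) (simp add: f_def)
    also have "\<dots> = 1" using V o' by simp
    finally show ?thesis by (simp add: Lp_norm_def)
  qed
  finally have "((q - 1) ^ d * (1 / n) powr p) powr (1/p) * (1 / q ^ d) powr (1/p) \<le> C * (1 / q ^ d) powr (1/p)"
    using q1 by (simp add: powr_mult[symmetric])
  moreover have "(1 / q ^ d) powr (1/p) > 0" using q_ge_2 by simp
  ultimately have "((q - 1) ^ d * (1 / n) powr p) powr (1/p) \<le> C" by simp
  also have "((q - 1) ^ d * (1 / n) powr p) powr (1/p) = ((q - 1) ^ d) powr (1/p) * (1 / n)"
    using q1 n p by (simp add: powr_mult powr_powr)
  also have "\<dots> = (q - 1) powr (d / p) / (q - 1) powr (real d - 1)"
    using q1 d by (simp add: n_def powr_realpow[symmetric] powr_powr of_nat_diff)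
  also have "\<dots> = (q - 1) powr (d / p - (real d - 1))" by (simp add: powr_diff)
  finally show ?thesis .
qed

end

section \<open>Prime fields and the equivalence\<close>

lemma finite_field_of_order_residue_ring:
  assumes "prime (p::nat)"
  shows "finite_field_of_order p (residue_ring (int p))"
proof -
  interpret residues_prime p "residue_ring (int p)"
    using assms by unfold_locales auto
  show ?thesis
    using field_axioms by (simp add: finite_field_of_order_def residue_ring_def)
qed

theorem theorem1p6:
  fixes d :: nat and p :: ereal
  assumes "d \<ge> 2" and "1 \<le> p"
  shows "(\<exists>C::real. \<forall>(q::nat) (F::int ring) (f::(nat \<Rightarrow> int) \<Rightarrow> complex).
            odd q \<and> primepow q \<and> finite_field_of_order q F \<longrightarrow>
            Lp_norm F d p (maximal_function F d f) \<le> C * Lp_norm F d p f)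
         \<longleftrightarrow> p \<ge> ereal (real d / (real d - 1))"
proof
  assume "\<exists>C::real. \<forall>(q::nat) (F::int ring) (f::(nat \<Rightarrow> int) \<Rightarrow> complex).
            odd q \<and> primepow q \<and> finite_field_of_order q F \<longrightarrow>
            Lp_norm F d p (maximal_function F d f) \<le> C * Lp_norm F d p f"
  then obtain C where C: "\<And>q F (f::(nat \<Rightarrow> int) \<Rightarrow> complex).
      odd q \<Longrightarrow> primepow q \<Longrightarrow> finite_field_of_order q F \<Longrightarrow>
      Lp_norm F d p (maximal_function F d f) \<le> C * Lp_norm F d p f" by blast
  show "p \<ge> ereal (real d / (real d - 1))"
  proof (cases p)
    case (real r)
    have r: "r \<ge> 1" using assms(2) real by simp
    define e where "e = d / r - (real d - 1)"
    have "e \<le> 0"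
    proof (rule ccontr)
      assume "\<not> e \<le> 0"
      then have e: "e > 0" by simp
      \<comment> \<open>Chosen so that \<open>B powr e = max C 1\<close>; a field with
        \<open>q - 1 > B\<close> then violates the lower bound on \<open>C\<close>.\<close>
      define B where "B = max C 1 powr (1/e)"
      obtain m :: nat where m: "B + 1 < real m" using reals_Archimedean2 by blast
      \<comment> \<open>Prime fields of odd order already supply arbitrarily large
        \<open>q\<close>.\<close>
      obtain P where P: "prime P" "P > max m 2" using bigger_prime by blast
      interpret finite_field "residue_ring (int P)"
        using finite_field_of_order_residue_ring[OF P(1)]
        by (simp add: finite_field_def finite_field_axioms_def finite_field_of_order_def)
      have "odd P" using P by (simp add: prime_odd_nat)
      moreover have "primepow P" using P by (simp add: primepow_prime)
      moreover have "finite_field_of_order P (residue_ring (int P))"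
        using P by (intro finite_field_of_order_residue_ring)
      ultimately have "Lp_norm (residue_ring (int P)) d (ereal r) (maximal_function (residue_ring (int P)) d f)
          \<le> C * Lp_norm (residue_ring (int P)) d (ereal r) f" for f :: "(nat \<Rightarrow> int) \<Rightarrow> complex"
        using C real by blast
      then have "(real (card (carrier (residue_ring (int P)))) - 1) powr e \<le> C"
        unfolding e_def using assms r by (intro Lp_constant_ge_point_mass) auto
      moreover have "card (carrier (residue_ring (int P))) = P"
        by (simp add: residue_ring_def)
      ultimately have "(real P - 1) powr e \<le> C" by simp
      moreover have "B < real P - 1" using m P by linarith
      then have "B powr e < (real P - 1) powr e"
        using e by (intro powr_less_mono2) (auto simp: B_def)
      moreover have "B powr e = max C 1" using e by (simp add: B_def powr_powr)
      ultimately show False by linarith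
    qed
    then have "d / r \<le> real d - 1" by (simp add: e_def)
    then have "d / (real d - 1) \<le> r"
      using r assms(1) by (simp add: field_simps)
    then show ?thesis using real by simp
  qed (use assms in auto)
next
  assume p: "p \<ge> ereal (real d / (real d - 1))"
  show "\<exists>C::real. \<forall>(q::nat) (F::int ring) (f::(nat \<Rightarrow> int) \<Rightarrow> complex).
            odd q \<and> primepow q \<and> finite_field_of_order q F \<longrightarrow>
            Lp_norm F d p (maximal_function F d f) \<le> C * Lp_norm F d p f"
  proof (cases p)
    case (real r)
    have "Lp_norm F d p (maximal_function F d f) \<le> maximal_const d powr (1/r) * Lp_norm F d p f"
      if "finite_field_of_order q F" for q F and f :: "(nat \<Rightarrow> int) \<Rightarrow> complex"
    proof -
      interpret finite_field F
        using that by (simp add: finite_field_def finite_field_axioms_def finite_field_of_order_def)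
      show ?thesis
        unfolding real using assms p real by (intro Lp_norm_maximal_function_le) (auto simp: endpoint_def)
    qed
    then show ?thesis by blast
  next
    case PInf
    have "Lp_norm F d p (maximal_function F d f) \<le> 1 * Lp_norm F d p f"
      if "finite_field_of_order q F" for q F and f :: "(nat \<Rightarrow> int) \<Rightarrow> complex"
    proof -
      interpret finite_field F
        using that by (simp add: finite_field_def finite_field_axioms_def finite_field_of_order_def)
      show ?thesis
        unfolding PInf using assms Max_norm_maximal_function_le[of d f] by simp
    qed
    then show ?thesis by blast
  qed (use p in auto)
qed

end
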